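(* Let $(S,A,\to)$ be an NPLTS and $s_1,s_2\in S$. Then $s_1\sim^{\mathrm{ct}}_{\mathrm{PTe}\text{-}\sqcup\sqcap}s_2$ if and only if $s_1\sim_{\mathrm{PTe}\text{-}\sqcup\sqcap}s_2$.
   Context: An NPLTS is a triple $(S,A,\to)$ where $S$ is an at most countable set of states, $A$ a countable set of actions, and $\to\subseteq S\times A\times\mathrm{Distr}(S)$ ($\mathrm{Distr}(S)$ = discrete probability distributions over $S$); write $s\xrightarrow{a}\mathcal D$, $\mathrm{supp}(\mathcal D)=\{s'\mid\mathcal D(s')>0\}$. A computation from $s_0$ is a sequence $s_0\xrightarrow{a_1}s_1\cdots\xrightarrow{a_n}s_n$ with transitions $s_{i-1}\xrightarrow{a_i}\mathcal D_i$, $s_i\in\mathrm{supp}(\mathcal D_i)$. A resolution of a state $x$ (deterministic scheduler) is an NPLTS $\mathcal Z=(Z,A,\to_{\mathcal Z})$, obtained by unfolding from a state $z_x$, with $\mathrm{corr}:Z\to$ (states), $\mathrm{corr}(z_x)=x$, such that for all $z$: (i) if $z\xrightarrow{a}_{\mathcal Z}\mathcal D$ then $\mathrm{corr}(z)\xrightarrow{a}\mathcal D'$ with $\mathcal D(z')=\mathcal D'(\mathrm{corr}(z'))$ for all $z'$; (ii) $z$ has at most one outgoing transition. It is maximal if it cannot be further extended in accordance with the graph structure of the NPLTS and these constraints. For randomized schedulers, (i) is replaced by: if $z\xrightarrow{a}_{\mathcal Z}\mathcal D$ then there are $n\ge1$, $p_i\in(0,1]$, $\sum p_i=1$, and transitions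 $\mathrm{corr}(z)\xrightarrow{a}\mathcal D_i$ with $\mathcal D(z')=\sum_ip_i\mathcal D_i(\mathrm{corr}(z'))$. $\mathrm{prob}(c)$ is the product of step probabilities of a finite computation in $\mathcal Z$, summed over sets of computations none of which is a proper prefix of another. An NPT (test) is a finite NPLTS $\mathcal T=(O,A,\to_{\mathcal T})$ (finitely many states and transitions, acyclic) with a distinguished success state $\omega\in O$ without outgoing transitions. The interaction system of $\mathcal L=(S,A,\to)$ and $\mathcal T$ is the NPLTS on $S\times O$ with $(s,o)\xrightarrow{a}\mathcal D$ iff $s\xrightarrow{a}\mathcal D_1$, $o\xrightarrow{a}_{\mathcal T}\mathcal D_2$ and $\mathcal D(s',o')=\mathcal D_1(s')\mathcal D_2(o')$. A computation is successful if its last configuration has the form $(s',\omega)$. $\mathrm{Res}_{\max}(s,o)$ (resp. $\mathrm{Res}^{\mathrm{ct}}_{\max}(s,o)$) is the set of maximal resolutions of $(s,o)$ in the interaction system via deterministic (resp. randomized) schedulers, and $\mathcal{SC}(z_{s,o})$ is the set of successful computations from $z_{s,o}$ in a resolution. $s_1\sim_{\mathrm{PTe}\text{-}\sqcup\sqcap}s_2$ iff for every NPT $\mathcal T$ with initial state $o$: $\sup_{\mathcal Z_1\in\mathrm{Res}_{\max}(s_1,o)}\mathrm{prob}(\mathcal{SC}(z_{s_1,o}))=\sup_{\mathcal Z_2\in\mathrm{Res}_{\max}(s_2,o)}\mathrm{prob}(\mathcal{SC}(z_{s_2,o}))$ and the same with $\inf$. $\sim^{\mathrm{ct}}_{\mathrm{PTe}\text{-}\sqcup\sqcap}$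 is defined identically with $\mathrm{Res}^{\mathrm{ct}}_{\max}$.
   Formalization: In a resolution (a tree), D(z')=D'(corr(z')), or its randomized analogue, is required only for z' in supp(D), and corr must be injective on supp(D); imposed on all z' without injectivity, the condition rules out genuine unfoldings or admits spurious duplicates of a state. *)

theory Defs
  imports "HOL-Probability.Probability"
begin

record ('s, 'a) nplts =
  states :: "'s set"
  actions :: "'a set"
  transitions :: "('s \<times> 'a \<times> 's pmf) set"

definition is_nplts :: "('s, 'a, 'm) nplts_scheme \<Rightarrow> bool" where
  "is_nplts L \<longleftrightarrow> countable (states L) \<and> countable (actions L) \<and>
     transitions L \<subseteq> states L \<times> actions L \<times> {D. set_pmf D \<subseteq> states L}"

text \<open>A computation \<open>s\<^sub>0 -a\<^sub>1\<rightarrow> s\<^sub>1 \<dots> -a\<^sub>n\<rightarrow> s\<^sub>n\<close> is given by its first state \<open>s\<^sub>0\<close> and the list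
  \<open>[(a\<^sub>1, s\<^sub>1), \<dots>, (a\<^sub>n, s\<^sub>n)]\<close>; the case \<open>n = 0\<close> is included.\<close>

fun computation :: "('s, 'a, 'm) nplts_scheme \<Rightarrow> 's \<Rightarrow> ('a \<times> 's) list \<Rightarrow> bool" where
  "computation L s [] \<longleftrightarrow> s \<in> states L"
| "computation L s ((a, s') # c) \<longleftrightarrow>
     (\<exists>D. (s, a, D) \<in> transitions L \<and> s' \<in> set_pmf D) \<and> computation L s' c"

definition last_state :: "'s \<Rightarrow> ('a \<times> 's) list \<Rightarrow> 's" where
  "last_state s c = last (s # map snd c)"

text \<open>Only used for systems in which every state has at most one outgoing transition.\<close>

fun prob :: "('z, 'a, 'm) nplts_scheme \<Rightarrow> 'z \<Rightarrow> ('a \<times> 'z) list \<Rightarrow> real" where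
  "prob Z z [] = 1"
| "prob Z z ((a, z') # c) = pmf (THE D. (z, a, D) \<in> transitions Z) z' * prob Z z' c"

definition prob_set :: "('z, 'a, 'm) nplts_scheme \<Rightarrow> 'z \<Rightarrow> ('a \<times> 'z) list set \<Rightarrow> ennreal" where
  "prob_set Z z C = (\<Sum>\<^sub>\<infinity>c\<in>C. ennreal (prob Z z c))"

text \<open>A scheduler kind says which mass functions a scheduler may choose for action \<open>a\<close> in state
  \<open>s\<close>: that of a single transition, or a convex combination of equally labelled transitions.\<close>

type_synonym ('s, 'a) scheduler_kind = "('s, 'a) nplts \<Rightarrow> 's \<Rightarrow> 'a \<Rightarrow> ('s \<Rightarrow> real) \<Rightarrow> bool"

definition deterministic :: "('s, 'a) scheduler_kind" where
  "deterministic L s a g \<longleftrightarrow> (\<exists>D'. (s, a, D') \<in> transitions L \<and> g = pmf D')"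

definition randomized :: "('s, 'a) scheduler_kind" where
  "randomized L s a g \<longleftrightarrow>
     (\<exists>n p D'. 1 \<le> (n::nat) \<and>
        (\<forall>i<n. 0 < p i \<and> p i \<le> (1::real) \<and> (s, a, D' i) \<in> transitions L) \<and>
        (\<Sum>i<n. p i) = 1 \<and>
        g = (\<lambda>s'. \<Sum>i<n. p i * pmf (D' i) s'))"

record ('z, 'a, 's) resolution = "('z, 'a) nplts" +
  init :: 'z
  corr :: "'z \<Rightarrow> 's"

text \<open>The system is a tree rooted at its initial state.\<close>

definition unfolded :: "('z, 'a, 's) resolution \<Rightarrow> bool" where
  "unfolded Z \<longleftrightarrow> init Z \<in> states Z \<and>
     (\<forall>z\<in>states Z. \<exists>!c. computation Z (init Z) c \<and> last_state (init Z) c = z)"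

text \<open>An unfolding may contain several copies of one and the same state, so a distribution of the
  resolution can agree with the chosen one only on its own support, and the support must contain
  at most one copy of each state. As the masses sum to 1, \<open>corr\<close> is then a bijection between the
  two supports.\<close>

definition is_resolution ::
  "('s, 'a) scheduler_kind \<Rightarrow> ('s, 'a) nplts \<Rightarrow> 's \<Rightarrow> ('z, 'a, 's) resolution \<Rightarrow> bool" where
  "is_resolution K L x Z \<longleftrightarrow>
     is_nplts Z \<and> actions Z = actions L \<and> unfolded Z \<and>
     corr Z ` states Z \<subseteq> states L \<and> corr Z (init Z) = x \<and>
     (\<forall>z a D. (z, a, D) \<in> transitions Z \<longrightarrow>
        (\<exists>g. K L (corr Z z) a g \<and> inj_on (corr Z) (set_pmf D) \<and>
           (\<forall>z'\<in>set_pmf D. pmf D z' = g (corr Z z')))) \<and>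
     (\<forall>z a\<^sub>1 D\<^sub>1 a\<^sub>2 D\<^sub>2. (z, a\<^sub>1, D\<^sub>1) \<in> transitions Z \<and> (z, a\<^sub>2, D\<^sub>2) \<in> transitions Z \<longrightarrow>
        a\<^sub>1 = a\<^sub>2 \<and> D\<^sub>1 = D\<^sub>2)"

definition rename_transitions ::
  "('z \<Rightarrow> 'y) \<Rightarrow> ('z \<times> 'a \<times> 'z pmf) set \<Rightarrow> ('y \<times> 'a \<times> 'y pmf) set" where
  "rename_transitions f R = (\<lambda>(z, a, D). (f z, a, map_pmf f D)) ` R"

text \<open>Extension is taken up to a renaming \<open>f\<close> of the states: inclusion on the nose would make
  maximality depend on which state names are still unused.\<close>

definition extends_via ::
  "('z \<Rightarrow> 'y) \<Rightarrow> ('z, 'a, 's) resolution \<Rightarrow> ('y, 'a, 's) resolution \<Rightarrow> bool" where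
  "extends_via f Z Z' \<longleftrightarrow>
     inj_on f (states Z) \<and> f ` states Z \<subseteq> states Z' \<and> f (init Z) = init Z' \<and>
     (\<forall>z\<in>states Z. corr Z' (f z) = corr Z z) \<and>
     rename_transitions f (transitions Z) \<subseteq> transitions Z'"

text \<open>Resolutions have at most countably many states, which are taken to be natural numbers.\<close>

definition Res_max ::
  "('s, 'a) scheduler_kind \<Rightarrow> ('s, 'a) nplts \<Rightarrow> 's \<Rightarrow> (nat, 'a, 's) resolution set" where
  "Res_max K L x = {Z. is_resolution K L x Z \<and>
     (\<forall>(Z' :: (nat, 'a, 's) resolution) f. is_resolution K L x Z' \<and> extends_via f Z Z' \<longrightarrow>
        f ` states Z = states Z' \<and> rename_transitions f (transitions Z) = transitions Z')}"

record ('o, 'a) npt = "('o, 'a) nplts" +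
  success :: 'o

definition is_npt :: "'a set \<Rightarrow> ('o, 'a) npt \<Rightarrow> bool" where
  "is_npt A T \<longleftrightarrow>
     is_nplts T \<and> actions T = A \<and> finite (states T) \<and> finite (transitions T) \<and>
     acyclic {(q, q'). \<exists>a D. (q, a, D) \<in> transitions T \<and> q' \<in> set_pmf D} \<and>
     success T \<in> states T \<and> (\<forall>a D. (success T, a, D) \<notin> transitions T)"

definition interaction :: "('s, 'a) nplts \<Rightarrow> ('o, 'a) npt \<Rightarrow> ('s \<times> 'o, 'a) nplts" where
  "interaction L T =
     \<lparr>states = states L \<times> states T,
      actions = actions L,
      transitions = {((s, q), a, pair_pmf D\<^sub>1 D\<^sub>2) | s q a D\<^sub>1 D\<^sub>2.
        (s, a, D\<^sub>1) \<in> transitions L \<and> (q, a, D\<^sub>2) \<in> transitions T}\<rparr>"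

definition successful_computations ::
  "('o, 'a) npt \<Rightarrow> ('z, 'a, 's \<times> 'o) resolution \<Rightarrow> ('a \<times> 'z) list set" where
  "successful_computations T Z =
     {c. computation Z (init Z) c \<and> snd (corr Z (last_state (init Z) c)) = success T}"

definition success_prob :: "('o, 'a) npt \<Rightarrow> ('z, 'a, 's \<times> 'o) resolution \<Rightarrow> ennreal" where
  "success_prob T Z = prob_set Z (init Z) (successful_computations T Z)"

text \<open>Tests have finitely many states, which are taken to be natural numbers.\<close>

definition PTe_sup_inf_equiv ::
  "('s \<times> nat, 'a) scheduler_kind \<Rightarrow> ('s, 'a) nplts \<Rightarrow> 's \<Rightarrow> 's \<Rightarrow> bool" where
  "PTe_sup_inf_equiv K L s\<^sub>1 s\<^sub>2 \<longleftrightarrow>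
     (\<forall>T :: (nat, 'a) npt. is_npt (actions L) T \<longrightarrow> (\<forall>q\<in>states T.
        (SUP Z\<^sub>1\<in>Res_max K (interaction L T) (s\<^sub>1, q). success_prob T Z\<^sub>1) =
        (SUP Z\<^sub>2\<in>Res_max K (interaction L T) (s\<^sub>2, q). success_prob T Z\<^sub>2) \<and>
        (INF Z\<^sub>1\<in>Res_max K (interaction L T) (s\<^sub>1, q). success_prob T Z\<^sub>1) =
        (INF Z\<^sub>2\<in>Res_max K (interaction L T) (s\<^sub>2, q). success_prob T Z\<^sub>2)))"

definition PTe_equiv :: "('s, 'a) nplts \<Rightarrow> 's \<Rightarrow> 's \<Rightarrow> bool" where
  "PTe_equiv = PTe_sup_inf_equiv deterministic"

definition PTe_ct_equiv :: "('s, 'a) nplts \<Rightarrow> 's \<Rightarrow> 's \<Rightarrow> bool" where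
  "PTe_ct_equiv = PTe_sup_inf_equiv randomized"

end

theory Submission
  imports Defs
begin

text \<open>Since tests are acyclic, the success probability of a resolution of an interaction system
  satisfies a recursion of bounded depth. Let \<open>V\<close> solve the Bellman equation in which the supremum
  (infimum) ranges over the single transitions of a state. The mean of \<open>V\<close> under a convex combination
  of distributions is bounded by the extremal means, so no maximal resolution, even a randomized one,
  beats \<open>V\<close>. Conversely, choosing in each state a transition that is optimal up to \<open>\<epsilon>\<close> and unfolding
  this choice gives a deterministic maximal resolution that misses \<open>V\<close> by at most \<open>\<epsilon>\<close> times the
  height of the test. Hence both scheduler kinds have the same suprema and infima, namely \<open>V\<close>. An
  optimal resolution need not exist, as a state may have infinitely many transitions.\<close>

section \<open>Sums and probability mass functions\<close>

text \<open>Bridges \<open>prob_set\<close>, an infinite sum, and the nonnegative integral, for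
  which Fubini is available. Finite partial sums are integrals of restrictions of \<open>f\<close>.
  Conversely a simple function below \<open>f\<close> either has finite support, so that its
  integral is bounded by a partial sum, or forces the sum to be infinite.\<close>

lemma nn_integral_count_space_eq_infsum:
  fixes f :: "'a \<Rightarrow> ennreal"
  shows "(\<integral>\<^sup>+x. f x \<partial>count_space A) = infsum f A"
proof (rule antisym)
  have sup: "infsum f A = (SUP F\<in>{F. finite F \<and> F \<subseteq> A}. sum f F)"
    by (rule nonneg_infsum_complete) simp
  show "infsum f A \<le> (\<integral>\<^sup>+x. f x \<partial>count_space A)"
    unfolding sup
  proof (rule SUP_least)
    fix F assume "F \<in> {F. finite F \<and> F \<subseteq> A}"
    then have F: "finite F" "F \<subseteq> A" by auto
    have "sum f F = (\<integral>\<^sup>+x. f x * indicator F x \<partial>count_space A)"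
      using F by (subst nn_integral_count_space'[of F]) auto
    also have "\<dots> \<le> (\<integral>\<^sup>+x. f x \<partial>count_space A)"
      by (rule nn_integral_mono) (auto split: split_indicator)
    finally show "sum f F \<le> (\<integral>\<^sup>+x. f x \<partial>count_space A)" .
  qed
  show "(\<integral>\<^sup>+x. f x \<partial>count_space A) \<le> infsum f A"
    unfolding nn_integral_def[of _ f]
  proof (rule SUP_least)
    fix g assume "g \<in> {g. simple_function (count_space A) g \<and> g \<le> f}"
    then have g: "simple_function (count_space A) g" and gf: "\<And>x. g x \<le> f x"
      by (auto simp: le_fun_def)
    have fin: "finite (g ` A)"
      using simple_functionD(1)[OF g] by simp
    let ?S = "{a\<in>A. 0 < g a}"
    show "integral\<^sup>S (count_space A) g \<le> infsum f A"
    proof (cases "finite ?S")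
      case True
      have "integral\<^sup>S (count_space A) g = (\<Sum>a\<in>?S. g a)"
        using nn_integral_count_space[OF True] nn_integral_eq_simple_integral[OF g] by simp
      also have "\<dots> \<le> sum f ?S"
        by (rule sum_mono) (rule gf)
      also have "\<dots> \<le> infsum f A"
        unfolding sup using True by (intro SUP_upper) auto
      finally show ?thesis .
    next
      case False
      \<comment> \<open>A simple function takes finitely many values, so there is a least positive
        one; \<open>f\<close> stays above it on an infinite set.\<close>
      define b where "b = Min (g ` ?S)"
      have finS: "finite (g ` ?S)"
        using fin by (rule finite_subset[rotated]) auto
      have ne: "g ` ?S \<noteq> {}"
        using False by (metis finite.emptyI image_is_empty)
      have "b \<in> g ` ?S"
        unfolding b_def using finS ne by (rule Min_in)
      then have "0 < b" by auto
      have "b \<le> f x" if "x \<in> ?S" for x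
        using order_trans[OF Min_le[OF finS] gf] that unfolding b_def by blast
      then have "infsum f ?S = \<infinity>"
        using \<open>0 < b\<close> False by (intro infsum_superconst_infinite_ennreal[of ?S b]) auto
      moreover have "infsum f ?S \<le> infsum f A"
        by (rule infsum_mono_neutral) (auto intro: nonneg_summable_on_complete)
      ultimately show ?thesis by (simp add: top_unique)
    qed
  qed
qed

lemma ennreal_divided_epsilon:
  assumes "0 < (e::real)"
  obtains \<epsilon> where "0 < \<epsilon>" and "of_nat n * ennreal \<epsilon> \<le> ennreal e"
proof
  \<comment> \<open>Dividing by \<open>Suc n\<close> instead of \<open>n\<close> keeps the quotient
    positive for \<open>n = 0\<close>.\<close>
  show "0 < e / real (Suc n)" using assms by simp
  have "real n * (e / real (Suc n)) \<le> e"
    using assms by (simp add: field_simps)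
  then show "of_nat n * ennreal (e / real (Suc n)) \<le> ennreal e"
    using assms by (simp add: ennreal_of_nat_eq_real_of_nat ennreal_mult'[symmetric] ennreal_leI)
qed

lemma nn_integral_pmf_add_const:
  "(\<integral>\<^sup>+z. f z + c \<partial>measure_pmf D) = (\<integral>\<^sup>+z. f z \<partial>measure_pmf D) + c"
  by (simp add: nn_integral_add)

text \<open>Both total masses are 1, so different distributions have a point where \<open>p\<close>
  exceeds \<open>q\<close>, and that point lies in the support of \<open>p\<close>.\<close>

lemma pmf_eq_if_eq_on_support:
  assumes "\<And>x. x \<in> set_pmf p \<Longrightarrow> pmf p x = pmf q x"
  shows "p = q"
proof (rule ccontr)
  assume "p \<noteq> q"
  then obtain x where "pmf q x < pmf p x"
    using pmf_neq_exists_less[of q p] by auto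
  moreover from this have "x \<in> set_pmf p"
    by (metis pmf_nonneg set_pmf_iff not_less)
  ultimately show False using assms by force
qed

text \<open>The weights form a distribution on indices, which turns the convex combination into a
  monadic mixture; integrals against it are then iterated integrals.\<close>

lemma randomized_eq_pmf_bind:
  assumes "randomized L s a g"
  obtains N :: "nat pmf" and D'
  where "\<And>i. i \<in> set_pmf N \<Longrightarrow> (s, a, D' i) \<in> transitions L" and "g = pmf (bind_pmf N D')"
proof -
  from assms obtain n :: nat and p D' where
    p: "\<And>i. i < n \<Longrightarrow> 0 < p i \<and> (s, a, D' i) \<in> transitions L" and
    one: "(\<Sum>i<n. p i) = 1" and g: "g = (\<lambda>s'. \<Sum>i<n. p i * pmf (D' i) s')"
    unfolding randomized_def by blast
  \<comment> \<open>Nothing is known about \<open>p\<close> from \<open>n\<close> on, so the weights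
    are cut off to \<open>0\<close> there.\<close>
  define w where "w = (\<lambda>i. if i < n then p i else (0::real))"
  have w0: "0 \<le> w i" for i using p[of i] by (auto simp: w_def)
  have "(\<integral>\<^sup>+i. ennreal (w i) \<partial>count_space UNIV) = (\<Sum>i<n. ennreal (w i))"
    by (rule nn_integral_count_space') (auto simp: w_def)
  also have "\<dots> = ennreal (\<Sum>i<n. w i)"
    using w0 by (intro sum_ennreal) auto
  also have "(\<Sum>i<n. w i) = 1"
    using one by (simp add: w_def)
  finally have w: "(\<integral>\<^sup>+i. ennreal (w i) \<partial>count_space UNIV) = 1" by simp
  define N where "N = embed_pmf w"
  have N: "pmf N i = w i" for i
    unfolding N_def using w0 w by (rule pmf_embed_pmf)
  then have supp: "i \<in> set_pmf N \<longleftrightarrow> w i \<noteq> 0" for i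
    by (simp add: set_pmf_iff)
  have "g s' = pmf (bind_pmf N D') s'" for s'
  proof -
    have "pmf (bind_pmf N D') s' = (\<Sum>i<n. pmf N i *\<^sub>R pmf (D' i) s')"
      unfolding pmf_bind
      by (rule integral_measure_pmf) (auto simp: supp w_def split: if_splits)
    then show ?thesis by (simp add: N g w_def)
  qed
  then have "g = pmf (bind_pmf N D')" by (rule ext)
  moreover have "(s, a, D' i) \<in> transitions L" if "i \<in> set_pmf N" for i
    using that p[of i] by (auto simp: supp w_def split: if_splits)
  ultimately show thesis
    by (rule that[rotated])
qed


section \<open>Trees\<close>

definition edges :: "('s, 'a, 'm) nplts_scheme \<Rightarrow> ('s \<times> 's) set" where
  "edges L = {(s, s'). \<exists>a D. (s, a, D) \<in> transitions L \<and> s' \<in> set_pmf D}"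

lemma is_npltsD:
  assumes "is_nplts L" and "(s, a, D) \<in> transitions L"
  shows "s \<in> states L" and "a \<in> actions L" and "set_pmf D \<subseteq> states L"
  using assms unfolding is_nplts_def by auto

lemma last_state_simps [simp]:
  "last_state s [] = s"
  "last_state s ((a, s') # c) = last_state s' c"
  "last_state s (c @ [(a, s')]) = s'"
  by (simp_all add: last_state_def)

text \<open>\<open>computation\<close> recurses on the first step, whereas a tree is traced back
  from the last one.\<close>

lemma computation_snoc:
  assumes "is_nplts L"
  shows "computation L s (c @ [(a, s')]) \<longleftrightarrow>
    computation L s c \<and> (\<exists>D. (last_state s c, a, D) \<in> transitions L \<and> s' \<in> set_pmf D)"
proof (induction c arbitrary: s)
  case Nil
  show ?case by (auto dest: is_npltsD(1)[OF assms] subsetD[OF is_npltsD(3)[OF assms]])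
next
  case (Cons x c)
  obtain b t where "x = (b, t)" by force
  with Cons.IH show ?case by auto
qed

lemma computation_last_state: "computation L s c \<Longrightarrow> last_state s c \<in> states L"
  by (induction c arbitrary: s) auto

text \<open>A local criterion for trees. Reachability yields a computation to each state. Two
  computations to the same state agree step by step from the end, since the parent and the label are
  determined, and they reach the root together, since nothing leads back into it.\<close>

lemma unfoldedI:
  assumes nplts: "is_nplts Z"
    and init: "init Z \<in> states Z"
    and reach: "\<And>z. z \<in> states Z \<Longrightarrow> (init Z, z) \<in> (edges Z)\<^sup>*"
    and root: "\<And>z. (z, init Z) \<notin> edges Z"
    and unique: "\<And>z\<^sub>1 a\<^sub>1 D\<^sub>1 z\<^sub>2 a\<^sub>2 D\<^sub>2 z'. (z\<^sub>1, a\<^sub>1, D\<^sub>1) \<in> transitions Z \<Longrightarrow> (z\<^sub>2, a\<^sub>2, D\<^sub>2) \<in> transitions Z \<Longrightarrow>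
      z' \<in> set_pmf D\<^sub>1 \<Longrightarrow> z' \<in> set_pmf D\<^sub>2 \<Longrightarrow> z\<^sub>1 = z\<^sub>2 \<and> a\<^sub>1 = a\<^sub>2"
  shows "unfolded Z"
proof -
  have ex: "\<exists>c. computation Z (init Z) c \<and> last_state (init Z) c = z"
    if "(init Z, z) \<in> (edges Z)\<^sup>*" for z
    using that
  proof (induction rule: rtrancl_induct)
    case base
    show ?case using init by (intro exI[of _ "[]"]) simp
  next
    case (step y z)
    then obtain c a D where "computation Z (init Z) c" "last_state (init Z) c = y"
      "(y, a, D) \<in> transitions Z" "z \<in> set_pmf D"
      unfolding edges_def by auto
    then show ?case
      using computation_snoc[OF nplts] by (intro exI[of _ "c @ [(a, z)]"]) auto
  qed
  have no_return: "c = []" if "computation Z (init Z) c" "last_state (init Z) c = init Z" for c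
  proof (cases c rule: rev_cases)
    case (snoc c' x)
    obtain b t where "x = (b, t)" by force
    with snoc that root show ?thesis
      by (auto simp: computation_snoc[OF nplts] edges_def)
  qed
  have un: "c = c'"
    if "computation Z (init Z) c" "computation Z (init Z) c'"
      "last_state (init Z) c = last_state (init Z) c'" for c c'
    using that
  proof (induction c arbitrary: c' rule: rev_induct)
    case Nil
    then show ?case using no_return[of c'] by simp
  next
    case (snoc x c)
    obtain a t where x: "x = (a, t)" by force
    show ?case
    proof (cases c' rule: rev_cases)
      case Nil
      then show ?thesis using snoc.prems no_return[of "c @ [x]"] by simp
    next
      case (snoc c'' x')
      obtain a' t' where x': "x' = (a', t')" by force
      from snoc.prems snoc x x' obtain D D' where
        *: "computation Z (init Z) c" "(last_state (init Z) c, a, D) \<in> transitions Z" "t \<in> set_pmf D"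
        "computation Z (init Z) c''" "(last_state (init Z) c'', a', D') \<in> transitions Z"
        "t \<in> set_pmf D'" "t = t'"
        by (auto simp: computation_snoc[OF nplts])
      from unique[OF *(2) *(5) *(3) *(6)]
      have "last_state (init Z) c = last_state (init Z) c''" "a = a'" by auto
      with snoc.IH[OF *(1) *(4)] *(7) show ?thesis
        by (simp add: snoc x x')
    qed
  qed
  show ?thesis
    unfolding unfolded_def using init ex[OF reach] un by metis
qed

text \<open>Converse of \<open>unfoldedI\<close>: a second parent, a second label, or a step into
  the root would give one state two computations.\<close>

lemma unfoldedD:
  assumes nplts: "is_nplts Z" and unf: "unfolded Z"
  shows unfolded_init: "init Z \<in> states Z"
    and unfolded_reach: "z \<in> states Z \<Longrightarrow> (init Z, z) \<in> (edges Z)\<^sup>*"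
    and unfolded_root: "(z, init Z) \<notin> edges Z"
    and unfolded_unique: "(z\<^sub>1, a\<^sub>1, D\<^sub>1) \<in> transitions Z \<Longrightarrow> (z\<^sub>2, a\<^sub>2, D\<^sub>2) \<in> transitions Z \<Longrightarrow>
      z' \<in> set_pmf D\<^sub>1 \<Longrightarrow> z' \<in> set_pmf D\<^sub>2 \<Longrightarrow> z\<^sub>1 = z\<^sub>2 \<and> a\<^sub>1 = a\<^sub>2"
proof -
  show init: "init Z \<in> states Z"
    using unf by (simp add: unfolded_def)
  have ex: "\<exists>c. computation Z (init Z) c \<and> last_state (init Z) c = z" if "z \<in> states Z" for z
    using unf that unfolding unfolded_def by blast
  have un: "c = c'" if "computation Z (init Z) c" "computation Z (init Z) c'"
    "last_state (init Z) c = last_state (init Z) c'" for c c'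
    using unf that computation_last_state[OF that(1)] unfolding unfolded_def by metis
  have reach: "(z, last_state z c) \<in> (edges Z)\<^sup>*" if "computation Z z c" for z c
    using that
  proof (induction c arbitrary: z)
    case (Cons x c)
    obtain b t where "x = (b, t)" by force
    with Cons have "(z, t) \<in> edges Z" "(t, last_state t c) \<in> (edges Z)\<^sup>*"
      by (auto simp: edges_def)
    then show ?case using \<open>x = (b, t)\<close> by (simp add: converse_rtrancl_into_rtrancl)
  qed simp
  show "(init Z, z) \<in> (edges Z)\<^sup>*" if "z \<in> states Z"
    using ex[OF that] reach by blast
  have ext: "\<exists>c. computation Z (init Z) (c @ [(a, z')]) \<and> last_state (init Z) c = z"
    if "(z, a, D) \<in> transitions Z" "z' \<in> set_pmf D" for z a D z'
    using ex[OF is_npltsD(1)[OF nplts that(1)]] that computation_snoc[OF nplts] by metis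
  show "(z, init Z) \<notin> edges Z"
  proof
    assume "(z, init Z) \<in> edges Z"
    then obtain c a where "computation Z (init Z) (c @ [(a, init Z)])"
      using ext unfolding edges_def by blast
    from un[OF this, of "[]"] init show False by simp
  qed
  show "z\<^sub>1 = z\<^sub>2 \<and> a\<^sub>1 = a\<^sub>2"
    if t: "(z\<^sub>1, a\<^sub>1, D\<^sub>1) \<in> transitions Z" "(z\<^sub>2, a\<^sub>2, D\<^sub>2) \<in> transitions Z"
      "z' \<in> set_pmf D\<^sub>1" "z' \<in> set_pmf D\<^sub>2"
  proof -
    obtain c\<^sub>1 where c1: "computation Z (init Z) (c\<^sub>1 @ [(a\<^sub>1, z')])" "last_state (init Z) c\<^sub>1 = z\<^sub>1"
      using ext[OF t(1,3)] by blast
    obtain c\<^sub>2 where c2: "computation Z (init Z) (c\<^sub>2 @ [(a\<^sub>2, z')])" "last_state (init Z) c\<^sub>2 = z\<^sub>2"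
      using ext[OF t(2,4)] by blast
    from un[OF c1(1) c2(1)] c1(2) c2(2) show ?thesis by auto
  qed
qed

section \<open>Maximal resolutions\<close>

text \<open>Characterizes maximality without reference to the scheduler kind.\<close>

definition exhaustive :: "('s, 'a) nplts \<Rightarrow> ('z, 'a, 's) resolution \<Rightarrow> bool" where
  "exhaustive M Z \<longleftrightarrow> (\<forall>z\<in>states Z.
     (\<exists>a D. (corr Z z, a, D) \<in> transitions M) \<longrightarrow> (\<exists>a D. (z, a, D) \<in> transitions Z))"

text \<open>The lower bound lets a scheduler pick any single transition, the upper bound makes every
  choice a convex combination. Results for all such kinds cover both equivalences at once.\<close>

definition admissible_kind :: "('s, 'a) scheduler_kind \<Rightarrow> bool" where
  "admissible_kind K \<longleftrightarrow> deterministic \<le> K \<and> K \<le> randomized"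

lemma deterministic_le_randomized: "(deterministic :: ('s, 'a) scheduler_kind) \<le> randomized"
proof (intro le_funI le_boolI)
  fix L :: "('s, 'a) nplts" and s a g
  assume "deterministic L s a g"
  then obtain D where "(s, a, D) \<in> transitions L" "g = pmf D"
    unfolding deterministic_def by blast
  then show "randomized L s a g"
    unfolding randomized_def
    by (intro exI[of _ "1::nat"] exI[of _ "\<lambda>_. 1::real"] exI[of _ "\<lambda>_. D"]) auto
qed

lemma admissible_kinds: "admissible_kind deterministic" "admissible_kind randomized"
  by (simp_all add: admissible_kind_def deterministic_le_randomized)

lemma admissible_kindD:
  assumes "admissible_kind K"
  shows "(s, a, D) \<in> transitions L \<Longrightarrow> K L s a (pmf D)"
    and "K L s a g \<Longrightarrow> randomized L s a g"
  using assms by (auto simp: admissible_kind_def deterministic_def le_fun_def) metis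

lemma is_resolution_mono:
  assumes "K \<le> K'" and "is_resolution K M x Z"
  shows "is_resolution K' M x Z"
proof -
  have "K M s a g \<Longrightarrow> K' M s a g" for s a g
    using assms(1) by (auto simp: le_fun_def)
  with assms(2) show ?thesis
    unfolding is_resolution_def by meson
qed

lemma is_resolutionD:
  assumes "is_resolution K M x Z"
  shows "is_nplts Z" and "actions Z = actions M" and "unfolded Z"
    and "corr Z ` states Z \<subseteq> states M" and "corr Z (init Z) = x"
    and "(z, a, D) \<in> transitions Z \<Longrightarrow>
      \<exists>g. K M (corr Z z) a g \<and> inj_on (corr Z) (set_pmf D) \<and>
        (\<forall>z'\<in>set_pmf D. pmf D z' = g (corr Z z'))"
    and "(z, a\<^sub>1, D\<^sub>1) \<in> transitions Z \<Longrightarrow> (z, a\<^sub>2, D\<^sub>2) \<in> transitions Z \<Longrightarrow> a\<^sub>1 = a\<^sub>2 \<and> D\<^sub>1 = D\<^sub>2"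
  using assms unfolding is_resolution_def by (elim conjE; simp)+

text \<open>Restates the pointwise condition on masses as an equation between distributions, which
  can be integrated. Injectivity of \<open>corr\<close> on the support preserves the masses, and
  agreement on the support is enough for equality.\<close>

lemma resolution_transition:
  assumes K: "admissible_kind K" and Z: "is_resolution K M x Z" and t: "(z, a, D) \<in> transitions Z"
  obtains N :: "nat pmf" and D'
  where "\<And>i. i \<in> set_pmf N \<Longrightarrow> (corr Z z, a, D' i) \<in> transitions M"
    and "map_pmf (corr Z) D = bind_pmf N D'"
proof -
  obtain g where g: "K M (corr Z z) a g" and inj: "inj_on (corr Z) (set_pmf D)"
    and eq: "\<And>z'. z' \<in> set_pmf D \<Longrightarrow> pmf D z' = g (corr Z z')"
    using is_resolutionD(6)[OF Z t] by blast
  obtain N :: "nat pmf" and D'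
    where N: "\<And>i. i \<in> set_pmf N \<Longrightarrow> (corr Z z, a, D' i) \<in> transitions M"
      and gN: "g = pmf (bind_pmf N D')"
    using randomized_eq_pmf_bind[OF admissible_kindD(2)[OF K, OF g]] by metis
  have "map_pmf (corr Z) D = bind_pmf N D'"
  proof (rule pmf_eq_if_eq_on_support)
    fix y assume "y \<in> set_pmf (map_pmf (corr Z) D)"
    then obtain z' where z': "z' \<in> set_pmf D" "y = corr Z z'" by auto
    with inj eq show "pmf (map_pmf (corr Z) D) y = pmf (bind_pmf N D') y"
      by (simp add: pmf_map_inj gN)
  qed
  with N show thesis by (rule that)
qed

lemma resolution_transition_exists:
  assumes "admissible_kind K" and "is_resolution K M x Z" and "(z, a, D) \<in> transitions Z"
  shows "\<exists>D. (corr Z z, a, D) \<in> transitions M"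
proof -
  obtain N :: "nat pmf" and D' where "\<And>i. i \<in> set_pmf N \<Longrightarrow> (corr Z z, a, D' i) \<in> transitions M"
    using resolution_transition[OF assms] by metis
  then show ?thesis
    using set_pmf_not_empty[of N] by blast
qed

text \<open>An extension cannot add a second transition to a state that has one, and a state without
  one corresponds to a deadlock of \<open>M\<close>. Hence, by induction along paths from the root,
  it contains no new states.\<close>

lemma exhaustive_imp_maximal:
  fixes Z :: "(nat, 'a, 's) resolution"
  assumes K: "admissible_kind K" and Z: "is_resolution K M x Z" and exh: "exhaustive M Z"
  shows "Z \<in> Res_max K M x"
proof -
  have "f ` states Z = states Z' \<and> rename_transitions f (transitions Z) = transitions Z'"
    if Z': "is_resolution K M x Z'" and ext: "extends_via f Z Z'"
    for Z' :: "(nat, 'a, 's) resolution" and f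
  proof -
    have ren: "(f z, a, map_pmf f D) \<in> transitions Z'" if "(z, a, D) \<in> transitions Z" for z a D
      using ext that unfolding extends_via_def rename_transitions_def by force
    have corr: "corr Z' (f z) = corr Z z" if "z \<in> states Z" for z
      using ext that by (auto simp: extends_via_def)
    \<comment> \<open>A transition of \<open>Z'\<close> from \<open>f z\<close> witnesses a
      transition of \<open>M\<close>, so by exhaustiveness \<open>z\<close> already has one in
      \<open>Z\<close>; as \<open>Z'\<close> has at most one per state, the two coincide up to
      renaming.\<close>
    have conv: "\<exists>D'. (z, a, D') \<in> transitions Z \<and> D = map_pmf f D'"
      if z: "z \<in> states Z" and t: "(f z, a, D) \<in> transitions Z'" for z a D
    proof -
      from resolution_transition_exists[OF K Z' t] corr[OF z] exh z
      obtain b D' where t': "(z, b, D') \<in> transitions Z"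
        unfolding exhaustive_def by fastforce
      from is_resolutionD(7)[OF Z' t ren[OF t']] t' show ?thesis by auto
    qed
    have sub: "states Z' \<subseteq> f ` states Z"
    proof
      fix z' assume "z' \<in> states Z'"
      then have "(init Z', z') \<in> (edges Z')\<^sup>*"
        by (rule unfolded_reach[OF is_resolutionD(1,3)[OF Z']])
      then show "z' \<in> f ` states Z"
      proof (induction rule: rtrancl_induct)
        case base
        show ?case
          using ext unfolded_init[OF is_resolutionD(1,3)[OF Z]] unfolding extends_via_def by (metis imageI)
      next
        case (step y y')
        then obtain z a D where "z \<in> states Z" "(f z, a, D) \<in> transitions Z'" "y' \<in> set_pmf D"
          unfolding edges_def by auto
        moreover from conv[OF this(1,2)] obtain D' where "(z, a, D') \<in> transitions Z" "D = map_pmf f D'"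
          by blast
        ultimately have "(z, a, D') \<in> transitions Z" "y' \<in> f ` set_pmf D'"
          by auto
        then show ?case using is_npltsD(3)[OF is_resolutionD(1)[OF Z]] by blast
      qed
    qed
    have "transitions Z' \<subseteq> rename_transitions f (transitions Z)"
    proof
      fix t assume t: "t \<in> transitions Z'"
      obtain z' a D where teq: "t = (z', a, D)" by (cases t)
      with t is_npltsD(1)[OF is_resolutionD(1)[OF Z']] sub
      obtain z where "z \<in> states Z" "z' = f z" by blast
      moreover from this t teq have "(f z, a, D) \<in> transitions Z'" by simp
      from conv[OF \<open>z \<in> states Z\<close> this] obtain D' where "(z, a, D') \<in> transitions Z" "D = map_pmf f D'"
        by blast
      ultimately have "(z, a, D') \<in> transitions Z" "t = (f z, a, map_pmf f D')"
        using teq by auto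
      then show "t \<in> rename_transitions f (transitions Z)"
        unfolding rename_transitions_def by force
    qed
    with sub ext show ?thesis
      unfolding extends_via_def by blast
  qed
  with Z show ?thesis
    unfolding Res_max_def by blast
qed

text \<open>If a leaf corresponds to a state that can move, attaching fresh copies of the support of
  one of its distributions gives a proper extension, legal for every admissible kind because a
  single transition is chosen.\<close>

lemma maximal_imp_exhaustive:
  fixes Z :: "(nat, 'a, 's) resolution"
  assumes K: "admissible_kind K" and M: "is_nplts M" and max: "Z \<in> Res_max K M x"
  shows "exhaustive M Z"
proof (rule ccontr)
  assume "\<not> exhaustive M Z"
  then obtain z a D where z: "z \<in> states Z" and t: "(corr Z z, a, D) \<in> transitions M"
    and leaf: "\<And>b E. (z, b, E) \<notin> transitions Z"
    unfolding exhaustive_def by blast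
  have Z: "is_resolution K M x Z"
    using max by (simp add: Res_max_def)
  note nZ = is_resolutionD(1)[OF Z] and uZ = is_resolutionD(1,3)[OF Z]
  have cM: "countable (states M)" using M by (simp add: is_nplts_def)
  have DM: "set_pmf D \<subseteq> states M" using is_npltsD(3)[OF M t] .
  \<comment> \<open>Even numbers name the old states, odd numbers the new leaves.\<close>
  define f :: "nat \<Rightarrow> nat" where "f = (\<lambda>n. 2 * n)"
  define e where "e = (\<lambda>y. 2 * to_nat_on (states M) y + 1)"
  define cr where "cr = (\<lambda>n. if even n then corr Z (n div 2) else from_nat_into (states M) (n div 2))"
  define Z' :: "(nat, 'a, 's) resolution" where
    "Z' = \<lparr>states = f ` states Z \<union> e ` set_pmf D, actions = actions M,
      transitions = insert (f z, a, map_pmf e D) (rename_transitions f (transitions Z)),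
      init = f (init Z), corr = cr\<rparr>"
  have cr_f [simp]: "cr (f n) = corr Z n" for n
    by (simp add: cr_def f_def)
  have cr_e: "cr (e y) = y" if "y \<in> set_pmf D" for y
    using that DM cM by (auto simp: cr_def e_def)
  have f_eq [simp]: "f n = f m \<longleftrightarrow> n = m" for n m by (simp add: f_def)
  have f_e [simp]: "f n \<noteq> e y" "e y \<noteq> f n" for n y
    unfolding f_def e_def by presburger+
  have e_inj: "inj_on e (set_pmf D)"
    by (rule inj_on_inverseI[of _ cr]) (rule cr_e)
  have trE: "(y, b, E) \<in> transitions Z' \<longleftrightarrow> (y, b, E) = (f z, a, map_pmf e D) \<or>
      (\<exists>y' E'. y = f y' \<and> E = map_pmf f E' \<and> (y', b, E') \<in> transitions Z)" for y b E
    by (force simp: Z'_def rename_transitions_def)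
  have [simp]: "init Z' = f (init Z)" "corr Z' = cr" "states Z' = f ` states Z \<union> e ` set_pmf D"
    "actions Z' = actions M"
    by (simp_all add: Z'_def)
  have nplts: "is_nplts Z'"
    unfolding is_nplts_def
  proof (intro conjI subsetI)
    show "countable (states Z')" by simp
    show "countable (actions Z')" using M by (simp add: is_nplts_def)
    fix tt assume tt: "tt \<in> transitions Z'"
    obtain y b E where "tt = (y, b, E)" by (cases tt)
    with tt trE[of y b E] is_npltsD[OF nZ] is_resolutionD(2)[OF Z] z is_npltsD(2)[OF M t]
    show "tt \<in> states Z' \<times> actions Z' \<times> {D. set_pmf D \<subseteq> states Z'}"
      by auto blast+
  qed
  have lift: "(f u, f v) \<in> (edges Z')\<^sup>*" if "(u, v) \<in> (edges Z)\<^sup>*" for u v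
    using that
  proof (induction rule: rtrancl_induct)
    case (step y y')
    then obtain b E where "(y, b, E) \<in> transitions Z" "y' \<in> set_pmf E"
      unfolding edges_def by blast
    then have "(f y, b, map_pmf f E) \<in> transitions Z'" "f y' \<in> set_pmf (map_pmf f E)"
      by (auto simp: trE)
    then have "(f y, f y') \<in> edges Z'" unfolding edges_def by blast
    with step.IH show ?case by (rule rtrancl_into_rtrancl)
  qed simp
  have unf: "unfolded Z'"
  proof (rule unfoldedI[OF nplts])
    show "init Z' \<in> states Z'" using unfolded_init[OF uZ] by simp
    show "(init Z', y) \<in> (edges Z')\<^sup>*" if "y \<in> states Z'" for y
    proof -
      have old: "(init Z', f u) \<in> (edges Z')\<^sup>*" if "u \<in> states Z" for u
        using lift[OF unfolded_reach[OF uZ that]] by simp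
      have "(f z, e u) \<in> edges Z'" if "u \<in> set_pmf D" for u
        using that trE[of "f z" a "map_pmf e D"] unfolding edges_def by force
      then have "(init Z', e u) \<in> (edges Z')\<^sup>*" if "u \<in> set_pmf D" for u
        using old[OF z] that by (meson rtrancl_into_rtrancl)
      with old that show ?thesis by auto
    qed
    show "(y, init Z') \<notin> edges Z'" for y
      using unfolded_root[OF uZ] unfolding edges_def by (auto simp: trE)
    show "z\<^sub>1 = z\<^sub>2 \<and> a\<^sub>1 = a\<^sub>2"
      if "(z\<^sub>1, a\<^sub>1, D\<^sub>1) \<in> transitions Z'" "(z\<^sub>2, a\<^sub>2, D\<^sub>2) \<in> transitions Z'"
        "z' \<in> set_pmf D\<^sub>1" "z' \<in> set_pmf D\<^sub>2" for z\<^sub>1 a\<^sub>1 D\<^sub>1 z\<^sub>2 a\<^sub>2 D\<^sub>2 z'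
      using that unfolded_unique[OF uZ] by (auto simp: trE)
  qed
  have res: "is_resolution K M x Z'"
    unfolding is_resolution_def
  proof (intro conjI allI impI)
    show "is_nplts Z'" "unfolded Z'" "actions Z' = actions M"
      by (fact nplts unf | simp)+
    show "corr Z' ` states Z' \<subseteq> states M"
      using is_resolutionD(4)[OF Z] DM cr_e by auto
    show "corr Z' (init Z') = x"
      using is_resolutionD(5)[OF Z] by simp
  next
    fix y b E assume "(y, b, E) \<in> transitions Z'"
    then consider "y = f z" "b = a" "E = map_pmf e D"
      | y' E' where "y = f y'" "E = map_pmf f E'" "(y', b, E') \<in> transitions Z"
      unfolding trE by blast
    then show "\<exists>g. K M (corr Z' y) b g \<and> inj_on (corr Z') (set_pmf E) \<and>
        (\<forall>z'\<in>set_pmf E. pmf E z' = g (corr Z' z'))"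
    proof cases
      case 1
      have "inj_on cr (set_pmf E)"
        by (rule inj_on_inverseI[of _ e]) (auto simp: 1 cr_e)
      moreover have "\<forall>z'\<in>set_pmf E. pmf E z' = pmf D (cr z')"
        using e_inj by (auto simp: 1 cr_e pmf_map_inj)
      ultimately show ?thesis
        using admissible_kindD(1)[OF K t] 1 by (intro exI[of _ "pmf D"]) simp
    next
      case 2
      obtain g where g: "K M (corr Z y') b g" "inj_on (corr Z) (set_pmf E')"
          "\<forall>z'\<in>set_pmf E'. pmf E' z' = g (corr Z z')"
        using is_resolutionD(6)[OF Z 2(3)] by blast
      have "inj f" by (simp add: inj_def)
      with g show ?thesis
        by (intro exI[of _ g]) (auto simp: 2 inj_on_def pmf_map_inj')
    qed
  next
    fix y a\<^sub>1 D\<^sub>1 a\<^sub>2 D\<^sub>2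
    assume "(y, a\<^sub>1, D\<^sub>1) \<in> transitions Z' \<and> (y, a\<^sub>2, D\<^sub>2) \<in> transitions Z'"
    then show "a\<^sub>1 = a\<^sub>2" "D\<^sub>1 = D\<^sub>2"
      using leaf is_resolutionD(7)[OF Z] by (auto simp: trE) blast+
  qed
  have "extends_via f Z Z'"
    unfolding extends_via_def by (auto simp: inj_on_def Z'_def)
  with max res have "rename_transitions f (transitions Z) = transitions Z'"
    unfolding Res_max_def by blast
  moreover have "(f z, a, map_pmf e D) \<in> transitions Z'"
    by (simp add: Z'_def)
  ultimately have "(f z, a, map_pmf e D) \<in> rename_transitions f (transitions Z)"
    by simp
  \<comment> \<open>By injectivity of \<open>f\<close>, a renamed transition from \<open>f z\<close>
    comes from a transition of \<open>z\<close>, which is a leaf.\<close>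
  then show False
    using leaf unfolding rename_transitions_def by auto
qed


section \<open>Unfolding a memoryless deterministic scheduler\<close>

text \<open>Paths with the latest state first, so that the tail of a history is its parent. Labels
  are not recorded because \<open>F\<close> will offer at most one per state.\<close>

inductive_set histories :: "('s \<times> 'a \<times> 's pmf) set \<Rightarrow> 's \<Rightarrow> 's list set"
  for F :: "('s \<times> 'a \<times> 's pmf) set" and x :: 's where
  start: "[x] \<in> histories F x"
| step: "y # p \<in> histories F x \<Longrightarrow> (y, a, D) \<in> F \<Longrightarrow> y' \<in> set_pmf D \<Longrightarrow> y' # y # p \<in> histories F x"

text \<open>The states of the unfolding are the histories of \<open>F\<close>. These are lists over
  a countable set and can be numbered; \<open>corr\<close> decodes a number and takes the head of
  the history. Since \<open>F\<close> offers a transition wherever \<open>M\<close> does, no state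
  stops early.\<close>

lemma unfolding_exists:
  fixes M :: "('s, 'a) nplts"
  assumes M: "is_nplts M" and x: "x \<in> states M" and F: "F \<subseteq> transitions M"
    and sv: "\<And>y a\<^sub>1 D\<^sub>1 a\<^sub>2 D\<^sub>2. (y, a\<^sub>1, D\<^sub>1) \<in> F \<Longrightarrow> (y, a\<^sub>2, D\<^sub>2) \<in> F \<Longrightarrow> a\<^sub>1 = a\<^sub>2 \<and> D\<^sub>1 = D\<^sub>2"
    and dom: "\<And>y a D. (y, a, D) \<in> transitions M \<Longrightarrow> \<exists>a D. (y, a, D) \<in> F"
  obtains Z :: "(nat, 'a, 's) resolution"
  where "is_resolution deterministic M x Z" and "exhaustive M Z"
    and "\<And>z a D. (z, a, D) \<in> transitions Z \<Longrightarrow> (corr Z z, a, map_pmf (corr Z) D) \<in> F"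
proof -
  let ?H = "histories F x"
  have HM: "?H \<subseteq> lists (states M)"
  proof
    fix p assume "p \<in> ?H"
    then show "p \<in> lists (states M)"
      by induction (use x subsetD[OF is_npltsD(3)[OF M subsetD[OF F]]] in auto)
  qed
  have cM: "countable (states M)" using M by (simp add: is_nplts_def)
  have cH: "countable ?H"
    using HM countable_lists[OF cM] by (rule countable_subset)
  define e where "e = to_nat_on ?H"
  define d where "d = from_nat_into ?H"
  have de [simp]: "d (e p) = p" if "p \<in> ?H" for p
    using that cH by (simp add: d_def e_def)
  have e_eq: "e p = e q \<longleftrightarrow> p = q" if "p \<in> ?H" "q \<in> ?H" for p q
    using de that by metis
  define Z :: "(nat, 'a, 's) resolution" where
    "Z = \<lparr>states = e ` ?H, actions = actions M,
      transitions = {(e (y # p), a, map_pmf (\<lambda>y'. e (y' # y # p)) D) | y p a D.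
        y # p \<in> ?H \<and> (y, a, D) \<in> F},
      init = e [x], corr = hd \<circ> d\<rparr>"
  have [simp]: "states Z = e ` ?H" "actions Z = actions M" "init Z = e [x]" "corr Z = hd \<circ> d"
    by (simp_all add: Z_def)
  have trE: "(z, a, E) \<in> transitions Z \<longleftrightarrow> (\<exists>y p D. z = e (y # p) \<and>
      E = map_pmf (\<lambda>y'. e (y' # y # p)) D \<and> y # p \<in> ?H \<and> (y, a, D) \<in> F)" for z a E
    by (auto simp: Z_def)
  have nplts: "is_nplts Z"
    unfolding is_nplts_def
  proof (intro conjI subsetI)
    show "countable (states Z)" by simp
    show "countable (actions Z)" using M by (simp add: is_nplts_def)
    fix t assume t: "t \<in> transitions Z"
    obtain z a E where "t = (z, a, E)" by (cases t)
    with t show "t \<in> states Z \<times> actions Z \<times> {D. set_pmf D \<subseteq> states Z}"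
      using F is_npltsD(2)[OF M] by (auto simp: trE intro!: imageI intro: histories.step)
  qed
  have edge: "(e (y # p), e (y' # y # p)) \<in> edges Z"
    if "y # p \<in> ?H" "(y, a, D) \<in> F" "y' \<in> set_pmf D" for y p a D y'
  proof -
    have "(e (y # p), a, map_pmf (\<lambda>y'. e (y' # y # p)) D) \<in> transitions Z"
      using that by (auto simp: trE)
    then show ?thesis using that(3) unfolding edges_def by force
  qed
  have edgeE: "\<exists>y p D y'. z = e (y # p) \<and> z' = e (y' # y # p) \<and> y # p \<in> ?H \<and> y' # y # p \<in> ?H \<and> (y, a, D) \<in> F"
    if "(z, a, E) \<in> transitions Z" "z' \<in> set_pmf E" for z a E z'
  proof -
    from that obtain y p D y' where *: "z = e (y # p)" "y # p \<in> ?H" "(y, a, D) \<in> F"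
      "y' \<in> set_pmf D" "z' = e (y' # y # p)"
      by (auto simp: trE)
    from histories.step[OF *(2-4)] * show ?thesis by blast
  qed
  have unf: "unfolded Z"
  proof (rule unfoldedI[OF nplts])
    show "init Z \<in> states Z" by (simp add: histories.start)
    show "(init Z, z) \<in> (edges Z)\<^sup>*" if "z \<in> states Z" for z
    proof -
      have "(e [x], e p) \<in> (edges Z)\<^sup>*" if "p \<in> ?H" for p
        using that
      proof induction
        case (step y p a D y')
        then show ?case using edge by (meson rtrancl_into_rtrancl)
      qed simp
      with that show ?thesis by auto
    qed
    show "(z, init Z) \<notin> edges Z" for z
    proof
      assume "(z, init Z) \<in> edges Z"
      then obtain y p y' where "e [x] = e (y' # y # p)" "y' # y # p \<in> ?H"
        using edgeE unfolding edges_def by force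
      then show False
        using e_eq[OF histories.start] by auto
    qed
    show "z\<^sub>1 = z\<^sub>2 \<and> a\<^sub>1 = a\<^sub>2"
      if t: "(z\<^sub>1, a\<^sub>1, D\<^sub>1) \<in> transitions Z" "(z\<^sub>2, a\<^sub>2, D\<^sub>2) \<in> transitions Z"
        "z' \<in> set_pmf D\<^sub>1" "z' \<in> set_pmf D\<^sub>2" for z\<^sub>1 a\<^sub>1 D\<^sub>1 z\<^sub>2 a\<^sub>2 D\<^sub>2 z'
    proof -
      from edgeE[OF t(1,3)] obtain y p D y' where 1: "z\<^sub>1 = e (y # p)" "(y, a\<^sub>1, D) \<in> F"
        "z' = e (y' # y # p)" "y' # y # p \<in> ?H"
        by blast
      from edgeE[OF t(2,4)] obtain v q E v' where 2: "z\<^sub>2 = e (v # q)" "(v, a\<^sub>2, E) \<in> F"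
        "z' = e (v' # v # q)" "v' # v # q \<in> ?H"
        by blast
      \<comment> \<open>Equal codes mean equal histories, hence equal tails: the child determines
        its parent, and \<open>sv\<close> then determines the label.\<close>
      from e_eq[OF 1(4) 2(4)] 1(3) 2(3) have "y = v" "p = q" by auto
      with 1 2 sv show ?thesis by blast
    qed
  qed
  have corr_tr: "(corr Z z, a, map_pmf (corr Z) E) \<in> F" and
    inj: "inj_on (corr Z) (set_pmf E)" if t: "(z, a, E) \<in> transitions Z" for z a E
  proof -
    from t obtain y p D where *: "z = e (y # p)" "E = map_pmf (\<lambda>y'. e (y' # y # p)) D"
      "y # p \<in> ?H" "(y, a, D) \<in> F"
      by (auto simp: trE)
    have H: "y' # y # p \<in> ?H" if "y' \<in> set_pmf D" for y'
      using *(3,4) that by (rule histories.step)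
    \<comment> \<open>Taking the head of a history undoes the map that put \<open>y'\<close> in
      front of \<open>y # p\<close>.\<close>
    have "map_pmf (corr Z) E = map_pmf (\<lambda>y'. y') D"
      unfolding *(2) map_pmf_comp by (rule map_pmf_cong) (simp_all add: H)
    with * show "(corr Z z, a, map_pmf (corr Z) E) \<in> F" by simp
    show "inj_on (corr Z) (set_pmf E)"
      by (rule inj_on_inverseI[of _ "\<lambda>y'. e (y' # y # p)"]) (auto simp: *(2) H)
  qed
  have "is_resolution deterministic M x Z"
    unfolding is_resolution_def
  proof (intro conjI allI impI)
    show "is_nplts Z" "unfolded Z" "actions Z = actions M"
      by (fact nplts unf | simp)+
    show "corr Z ` states Z \<subseteq> states M"
    proof -
      have "hd p \<in> states M" if "p \<in> ?H" for p
      proof -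
        have "p \<noteq> []" using that by (cases rule: histories.cases) auto
        moreover have "p \<in> lists (states M)" using that HM by blast
        ultimately show ?thesis by (auto simp: neq_Nil_conv)
      qed
      then show ?thesis by auto
    qed
    show "corr Z (init Z) = x" by (simp add: histories.start)
  next
    fix z a E assume t: "(z, a, E) \<in> transitions Z"
    have "deterministic M (corr Z z) a (pmf (map_pmf (corr Z) E))"
      by (rule admissible_kindD(1)[OF admissible_kinds(1) subsetD[OF F corr_tr[OF t]]])
    moreover have "pmf E z' = pmf (map_pmf (corr Z) E) (corr Z z')" if "z' \<in> set_pmf E" for z'
      using pmf_map_inj[OF inj[OF t] that] by (rule sym)
    ultimately show "\<exists>g. deterministic M (corr Z z) a g \<and> inj_on (corr Z) (set_pmf E) \<and>
        (\<forall>z'\<in>set_pmf E. pmf E z' = g (corr Z z'))"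
      using inj[OF t] by (intro exI[of _ "pmf (map_pmf (corr Z) E)"] conjI ballI)
  next
    fix z a\<^sub>1 D\<^sub>1 a\<^sub>2 D\<^sub>2
    assume t: "(z, a\<^sub>1, D\<^sub>1) \<in> transitions Z \<and> (z, a\<^sub>2, D\<^sub>2) \<in> transitions Z"
    from t[THEN conjunct1] obtain y p E\<^sub>1 where 1: "z = e (y # p)"
        "D\<^sub>1 = map_pmf (\<lambda>y'. e (y' # y # p)) E\<^sub>1" "y # p \<in> ?H" "(y, a\<^sub>1, E\<^sub>1) \<in> F"
      by (auto simp: trE)
    from t[THEN conjunct2] obtain v q E\<^sub>2 where 2: "z = e (v # q)"
        "D\<^sub>2 = map_pmf (\<lambda>y'. e (y' # v # q)) E\<^sub>2" "v # q \<in> ?H" "(v, a\<^sub>2, E\<^sub>2) \<in> F"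
      by (auto simp: trE)
    note * = 1 2
    from e_eq[OF *(3,7)] *(1,5) have "v = y" "q = p" by auto
    with sv[OF *(4)] *(8) have "a\<^sub>1 = a\<^sub>2" "E\<^sub>1 = E\<^sub>2" by auto
    then show "a\<^sub>1 = a\<^sub>2" "D\<^sub>1 = D\<^sub>2" using *(2,6) \<open>v = y\<close> \<open>q = p\<close> by auto
  qed
  moreover have "exhaustive M Z"
    unfolding exhaustive_def
  proof (intro ballI impI)
    fix z assume "z \<in> states Z" and ex: "\<exists>a D. (corr Z z, a, D) \<in> transitions M"
    then obtain p where p: "p \<in> ?H" "z = e p" by auto
    then obtain y q where "p = y # q" by (cases rule: histories.cases) auto
    with p have "corr Z z = y" by simp
    with ex dom obtain a D where "(y, a, D) \<in> F" by metis
    with p \<open>p = y # q\<close> have "(z, a, map_pmf (\<lambda>y'. e (y' # y # q)) D) \<in> transitions Z"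
      by (auto simp: trE)
    then show "\<exists>a D. (z, a, D) \<in> transitions Z" by (intro exI)
  qed
  ultimately show thesis
    using corr_tr by (rule that)
qed


section \<open>Optimal success probabilities\<close>

text \<open>Isolates what interaction with a test provides: \<open>good\<close> stands for success,
  and \<open>height\<close> is a rank that decreases along every step and carries the
  inductions.\<close>

locale bounded_depth_system =
  fixes M :: "('s, 'a) nplts" and good :: "'s \<Rightarrow> bool" and height :: "'s \<Rightarrow> nat"
  assumes nplts: "is_nplts M"
    and good_deadlock: "good y \<Longrightarrow> (y, t) \<notin> transitions M"
    and height_decreases: "(y, a, D) \<in> transitions M \<Longrightarrow> y' \<in> set_pmf D \<Longrightarrow> height y' < height y"
begin

section \<open>Reachability probabilities within one resolution\<close>

definition reach_computations :: "('z, 'a, 's) resolution \<Rightarrow> 'z \<Rightarrow> ('a \<times> 'z) list set" where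
  "reach_computations Z z = {c. computation Z z c \<and> good (corr Z (last_state z c))}"

definition reach_prob :: "('z, 'a, 's) resolution \<Rightarrow> 'z \<Rightarrow> ennreal" where
  "reach_prob Z z = prob_set Z z (reach_computations Z z)"

text \<open>The support of a mixture is covered by the supports of its components, so the rank also
  decreases under randomized choices.\<close>

lemma resolution_height_decreases:
  assumes "admissible_kind K" and "is_resolution K M x Z" and "(z, a, D) \<in> transitions Z"
    and "z' \<in> set_pmf D"
  shows "height (corr Z z') < height (corr Z z)"
proof -
  obtain N :: "nat pmf" and D'
    where N: "\<And>i. i \<in> set_pmf N \<Longrightarrow> (corr Z z, a, D' i) \<in> transitions M"
      and D: "map_pmf (corr Z) D = bind_pmf N D'"
    using resolution_transition[OF assms(1-3)] by metis
  have "corr Z z' \<in> set_pmf (bind_pmf N D')"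
    unfolding D[symmetric] using assms(4) by simp
  then obtain i where "i \<in> set_pmf N" "corr Z z' \<in> set_pmf (D' i)"
    by auto
  with N show ?thesis by (blast intro: height_decreases)
qed

lemma reach_prob_deadlock:
  assumes "z \<in> states Z" and "\<And>t. (z, t) \<notin> transitions Z"
  shows "reach_prob Z z = (if good (corr Z z) then 1 else 0)"
proof -
  have "reach_computations Z z = (if good (corr Z z) then {[]} else {})"
  proof -
    have "computation Z z c \<longleftrightarrow> c = []" for c
      using assms by (cases c) auto
    then have "reach_computations Z z = {c. c = [] \<and> good (corr Z z)}"
      unfolding reach_computations_def by (intro Collect_cong) (simp cong: conj_cong)
    then show ?thesis
      by simp
  qed
  then show ?thesis
    by (simp add: reach_prob_def prob_set_def)
qed

text \<open>Successful computations from \<open>z\<close> correspond to pairs of a first successor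
  and a successful computation from there; Fubini for counting measures splits the sum
  accordingly.\<close>

lemma reach_prob_step:
  assumes K: "admissible_kind K" and Z: "is_resolution K M x Z" and t: "(z, a, D) \<in> transitions Z"
  shows "reach_prob Z z = (\<integral>\<^sup>+z'. reach_prob Z z' \<partial>measure_pmf D)"
proof -
  let ?S = "reach_computations Z"
  \<comment> \<open>Makes the definite description in \<open>prob\<close> evaluate to
    \<open>D\<close>.\<close>
  have uniq: "(z, b, E) \<in> transitions Z \<longleftrightarrow> b = a \<and> E = D" for b E
    using is_resolutionD(7)[OF Z t] t by blast
  \<comment> \<open>Excludes the empty computation, so every successful one begins with the step to
    \<open>D\<close>.\<close>
  have not_good: "\<not> good (corr Z z)"
    using resolution_transition_exists[OF K Z t] good_deadlock by blast
  define \<phi> where "\<phi> = (\<lambda>(z', c). (a, z') # c :: ('a \<times> 'b) list)"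
  have S: "?S z = \<phi> ` Sigma (set_pmf D) ?S"
  proof (intro set_eqI iffI)
    fix c assume "c \<in> ?S z"
    then have c: "computation Z z c" "good (corr Z (last_state z c))"
      by (auto simp: reach_computations_def)
    with not_good obtain b z' c' where [simp]: "c = (b, z') # c'"
      by (cases c) auto
    from c have "b = a" "z' \<in> set_pmf D" "c' \<in> ?S z'"
      by (auto simp: uniq reach_computations_def)
    then show "c \<in> \<phi> ` Sigma (set_pmf D) ?S"
      by (force simp: \<phi>_def)
  next
    fix c assume "c \<in> \<phi> ` Sigma (set_pmf D) ?S"
    then show "c \<in> ?S z"
      using t by (auto simp: \<phi>_def reach_computations_def)
  qed
  have inj: "inj_on \<phi> A" for A
    by (auto simp: \<phi>_def inj_on_def)
  have prob_\<phi>: "ennreal (prob Z z (\<phi> (z', c))) = ennreal (pmf D z') * ennreal (prob Z z' c)" for z' c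
    by (simp add: \<phi>_def uniq ennreal_mult')
  have reach: "reach_prob Z y = (\<integral>\<^sup>+c. ennreal (prob Z y c) * indicator (?S y) c \<partial>count_space UNIV)" for y
    unfolding reach_prob_def prob_set_def nn_integral_count_space_eq_infsum[symmetric]
    by (simp add: nn_integral_count_space_indicator)
  have "reach_prob Z z = (\<Sum>\<^sub>\<infinity>p\<in>Sigma (set_pmf D) ?S. ennreal (prob Z z (\<phi> p)))"
    unfolding reach_prob_def prob_set_def S infsum_reindex[OF inj] by (simp add: o_def)
  also have "\<dots> = (\<integral>\<^sup>+p. ennreal (prob Z z (\<phi> p)) * indicator (Sigma (set_pmf D) ?S) p \<partial>count_space UNIV)"
    unfolding nn_integral_count_space_eq_infsum[symmetric]
    by (simp add: nn_integral_count_space_indicator)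
  also have "\<dots> = (\<integral>\<^sup>+z'. \<integral>\<^sup>+c. ennreal (prob Z z (\<phi> (z', c))) *
      indicator (Sigma (set_pmf D) ?S) (z', c) \<partial>count_space UNIV \<partial>count_space UNIV)"
    by (rule nn_integral_fst_count_space[symmetric])
  also have "\<dots> = (\<integral>\<^sup>+z'. \<integral>\<^sup>+c. ennreal (pmf D z') * (ennreal (prob Z z' c) * indicator (?S z') c)
      \<partial>count_space UNIV \<partial>count_space UNIV)"
    unfolding prob_\<phi>
    by (intro nn_integral_cong) (auto simp: set_pmf_iff mult.assoc split: split_indicator)
  also have "\<dots> = (\<integral>\<^sup>+z'. ennreal (pmf D z') * reach_prob Z z' \<partial>count_space UNIV)"
    unfolding reach by (simp add: nn_integral_cmult)
  also have "\<dots> = (\<integral>\<^sup>+z'. reach_prob Z z' \<partial>measure_pmf D)"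
    by (rule nn_integral_measure_pmf[symmetric])
  finally show ?thesis .
qed

section \<open>Comparison with approximate solutions of the recursion\<close>

text \<open>A supersolution up to \<epsilon> bounds the probability from above, the errors adding up
  over at most \<open>height\<close> steps. At deadlocks that are not good the bound is trivial, as
  \<open>W\<close> is nonnegative.\<close>

lemma reach_prob_le:
  assumes K: "admissible_kind K" and Z: "is_resolution K M x Z"
    and good: "\<And>z. z \<in> states Z \<Longrightarrow> good (corr Z z) \<Longrightarrow> 1 \<le> W z"
    and step: "\<And>z a D. (z, a, D) \<in> transitions Z \<Longrightarrow> (\<integral>\<^sup>+z'. W z' \<partial>measure_pmf D) \<le> W z + \<epsilon>"
    and z: "z \<in> states Z"
  shows "reach_prob Z z \<le> W z + of_nat (height (corr Z z)) * \<epsilon>"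
  using z
proof (induction "height (corr Z z)" arbitrary: z rule: less_induct)
  case less
  show ?case
  proof (cases "\<exists>t. (z, t) \<in> transitions Z")
    case False
    then have "reach_prob Z z = (if good (corr Z z) then 1 else 0)"
      using less.prems by (intro reach_prob_deadlock) auto
    also have "\<dots> \<le> W z"
      using good[OF less.prems] by simp
    finally show ?thesis
      by (rule order_trans) simp
  next
    case True
    then obtain a D where t: "(z, a, D) \<in> transitions Z" by auto
    let ?n = "height (corr Z z)"
    \<comment> \<open>Makes \<open>?n - 1\<close> a true predecessor: the successors use up at most
      \<open>?n - 1\<close> errors, leaving one for the present step.\<close>
    have "0 < ?n"
      using resolution_height_decreases[OF K Z t] set_pmf_not_empty[of D] by fastforce
    have IH: "reach_prob Z z' \<le> W z' + of_nat (?n - 1) * \<epsilon>" if z': "z' \<in> set_pmf D" for z'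
    proof -
      have h: "height (corr Z z') < ?n"
        by (rule resolution_height_decreases[OF K Z t z'])
      have "reach_prob Z z' \<le> W z' + of_nat (height (corr Z z')) * \<epsilon>"
        using less.hyps[OF h] is_npltsD(3)[OF is_resolutionD(1)[OF Z] t] z' by blast
      also have "\<dots> \<le> W z' + of_nat (?n - 1) * \<epsilon>"
        using h by (intro add_left_mono mult_right_mono) auto
      finally show ?thesis .
    qed
    have "reach_prob Z z \<le> (\<integral>\<^sup>+z'. W z' + of_nat (?n - 1) * \<epsilon> \<partial>measure_pmf D)"
      unfolding reach_prob_step[OF K Z t]
      by (rule nn_integral_mono_AE) (simp add: AE_measure_pmf_iff IH del: One_nat_def)
    also have "\<dots> \<le> W z + \<epsilon> + of_nat (?n - 1) * \<epsilon>"
      unfolding nn_integral_pmf_add_const using step[OF t] by (rule add_right_mono)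
    also have "\<dots> = W z + of_nat (Suc (?n - 1)) * \<epsilon>"
      by (simp add: distrib_right add.assoc)
    finally show ?thesis using \<open>0 < ?n\<close> by simp
  qed
qed

text \<open>The dual bound for subsolutions. Here deadlocks do need control, because a resolution
  that stops early would lose probability.\<close>

lemma le_reach_prob:
  assumes K: "admissible_kind K" and Z: "is_resolution K M x Z"
    and deadlock: "\<And>z. z \<in> states Z \<Longrightarrow> (\<And>t. (z, t) \<notin> transitions Z) \<Longrightarrow>
      W z \<le> (if good (corr Z z) then 1 else 0)"
    and step: "\<And>z a D. (z, a, D) \<in> transitions Z \<Longrightarrow> W z \<le> (\<integral>\<^sup>+z'. W z' \<partial>measure_pmf D) + \<epsilon>"
    and z: "z \<in> states Z"
  shows "W z \<le> reach_prob Z z + of_nat (height (corr Z z)) * \<epsilon>"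
  using z
proof (induction "height (corr Z z)" arbitrary: z rule: less_induct)
  case less
  show ?case
  proof (cases "\<exists>t. (z, t) \<in> transitions Z")
    case False
    then have "W z \<le> (if good (corr Z z) then 1 else 0)"
      using less.prems by (intro deadlock) auto
    also have "\<dots> = reach_prob Z z"
      using less.prems False by (intro reach_prob_deadlock[symmetric]) auto
    finally show ?thesis
      by (rule order_trans) simp
  next
    case True
    then obtain a D where t: "(z, a, D) \<in> transitions Z" by auto
    let ?n = "height (corr Z z)"
    have "0 < ?n"
      using resolution_height_decreases[OF K Z t] set_pmf_not_empty[of D] by fastforce
    have IH: "W z' \<le> reach_prob Z z' + of_nat (?n - 1) * \<epsilon>" if z': "z' \<in> set_pmf D" for z'
    proof -
      have h: "height (corr Z z') < ?n"
        by (rule resolution_height_decreases[OF K Z t z'])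
      have "W z' \<le> reach_prob Z z' + of_nat (height (corr Z z')) * \<epsilon>"
        using less.hyps[OF h] is_npltsD(3)[OF is_resolutionD(1)[OF Z] t] z' by blast
      also have "\<dots> \<le> reach_prob Z z' + of_nat (?n - 1) * \<epsilon>"
        using h by (intro add_left_mono mult_right_mono) auto
      finally show ?thesis .
    qed
    have "W z \<le> (\<integral>\<^sup>+z'. W z' \<partial>measure_pmf D) + \<epsilon>"
      by (rule step[OF t])
    also have "\<dots> \<le> (\<integral>\<^sup>+z'. reach_prob Z z' + of_nat (?n - 1) * \<epsilon> \<partial>measure_pmf D) + \<epsilon>"
      by (intro add_right_mono nn_integral_mono_AE) (simp add: AE_measure_pmf_iff IH del: One_nat_def)
    also have "\<dots> = reach_prob Z z + of_nat (Suc (?n - 1)) * \<epsilon>"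
      unfolding nn_integral_pmf_add_const reach_prob_step[OF K Z t]
      by (simp add: distrib_right add_ac)
    finally show ?thesis using \<open>0 < ?n\<close> by simp
  qed
qed

section \<open>Bellman equations and their least solutions\<close>

definition choices :: "'s \<Rightarrow> ('a \<times> 's pmf) set" where
  "choices y = {t. (y, t) \<in> transitions M}"

definition mean :: "('s \<Rightarrow> ennreal) \<Rightarrow> 'a \<times> 's pmf \<Rightarrow> ennreal" where
  "mean V t = (\<integral>\<^sup>+y. V y \<partial>measure_pmf (snd t))"

text \<open>The Bellman operator of maximal reachability; at a deadlock that is not good, the empty
  supremum is already \<open>0\<close>.\<close>

definition sup_step :: "('s \<Rightarrow> ennreal) \<Rightarrow> 's \<Rightarrow> ennreal" where
  "sup_step V y = (if good y then 1 else SUP t\<in>choices y. mean V t)"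

text \<open>The empty infimum would be \<open>\<infinity>\<close>, hence the extra case.\<close>

definition inf_step :: "('s \<Rightarrow> ennreal) \<Rightarrow> 's \<Rightarrow> ennreal" where
  "inf_step V y = (if good y then 1 else if choices y = {} then 0 else INF t\<in>choices y. mean V t)"

definition sup_value :: "'s \<Rightarrow> ennreal" where "sup_value = lfp sup_step"
definition inf_value :: "'s \<Rightarrow> ennreal" where "inf_value = lfp inf_step"

lemma mean_mono: "V \<le> V' \<Longrightarrow> mean V t \<le> mean V' t"
  unfolding mean_def by (intro nn_integral_mono) (simp add: le_fun_def)

lemma mean_const: "mean (\<lambda>_. c) t = c"
  by (simp add: mean_def)

lemma sup_value_unfold: "sup_value = sup_step sup_value"
proof -
  have "mono sup_step"
    by (rule monoI) (auto simp: sup_step_def le_fun_def[of "sup_step _"] intro!: SUP_mono' mean_mono)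
  then show ?thesis unfolding sup_value_def by (rule lfp_unfold)
qed

lemma inf_value_unfold: "inf_value = inf_step inf_value"
proof -
  have "mono inf_step"
    by (rule monoI) (auto simp: inf_step_def le_fun_def[of "inf_step _"] intro!: INF_mono' mean_mono)
  then show ?thesis unfolding inf_value_def by (rule lfp_unfold)
qed

text \<open>The constant \<open>1\<close> is a pre-fixed point. The bound makes the value finite, so
  that the supremum can be approached within a positive error.\<close>

lemma sup_value_le_1: "sup_value y \<le> 1"
proof -
  have "sup_step (\<lambda>_. 1) \<le> (\<lambda>_. 1)"
    by (auto simp: le_fun_def sup_step_def mean_const intro: SUP_least)
  then have "sup_value \<le> (\<lambda>_. 1)"
    unfolding sup_value_def by (rule lfp_lowerbound)
  then show ?thesis by (simp add: le_fun_def)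
qed

lemma inf_value_le_1: "inf_value y \<le> 1"
proof -
  have "inf_step (\<lambda>_. 1) \<le> (\<lambda>_. 1)"
    by (auto simp: le_fun_def inf_step_def mean_const)
  then have "inf_value \<le> (\<lambda>_. 1)"
    unfolding inf_value_def by (rule lfp_lowerbound)
  then show ?thesis by (simp add: le_fun_def)
qed

lemma sup_value_good: "good y \<Longrightarrow> sup_value y = 1"
  by (subst sup_value_unfold) (simp add: sup_step_def)

lemma inf_value_good: "good y \<Longrightarrow> inf_value y = 1"
  by (subst inf_value_unfold) (simp add: inf_step_def)

lemma not_good_if_choices: "choices y \<noteq> {} \<Longrightarrow> \<not> good y"
  using good_deadlock by (auto simp: choices_def)

lemma sup_value_choices: "choices y \<noteq> {} \<Longrightarrow> sup_value y = (SUP t\<in>choices y. mean sup_value t)"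
  by (subst sup_value_unfold) (simp add: sup_step_def not_good_if_choices)

lemma inf_value_choices: "choices y \<noteq> {} \<Longrightarrow> inf_value y = (INF t\<in>choices y. mean inf_value t)"
  by (subst inf_value_unfold) (simp add: inf_step_def not_good_if_choices)

lemma sup_value_deadlock: "choices y = {} \<Longrightarrow> sup_value y = (if good y then 1 else 0)"
  by (subst sup_value_unfold) (simp add: sup_step_def bot_ennreal)

lemma inf_value_deadlock: "choices y = {} \<Longrightarrow> inf_value y = (if good y then 1 else 0)"
  by (subst inf_value_unfold) (simp add: inf_step_def)

text \<open>Randomization does not help: the mean of a convex combination of distributions lies between
  the extremal means of the distributions combined.\<close>

lemma resolution_step_bounds:
  assumes K: "admissible_kind K" and Z: "is_resolution K M x Z" and t: "(z, a, D) \<in> transitions Z"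
  shows "(\<integral>\<^sup>+z'. sup_value (corr Z z') \<partial>measure_pmf D) \<le> sup_value (corr Z z)"
    and "inf_value (corr Z z) \<le> (\<integral>\<^sup>+z'. inf_value (corr Z z') \<partial>measure_pmf D)"
proof -
  obtain N :: "nat pmf" and D'
    where N: "\<And>i. i \<in> set_pmf N \<Longrightarrow> (corr Z z, a, D' i) \<in> transitions M"
      and D: "map_pmf (corr Z) D = bind_pmf N D'"
    using resolution_transition[OF K Z t] by metis
  \<comment> \<open>Averaging over \<open>D\<close> becomes a two-stage average: an index from
    \<open>N\<close>, then a state from \<open>D' i\<close>.\<close>
  have eq: "(\<integral>\<^sup>+z'. V (corr Z z') \<partial>measure_pmf D) = (\<integral>\<^sup>+i. mean V (a, D' i) \<partial>measure_pmf N)" for V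
    using arg_cong[OF D, of "\<lambda>p. \<integral>\<^sup>+y. V y \<partial>measure_pmf p"] by (simp add: mean_def)
  have ch: "(a, D' i) \<in> choices (corr Z z)" if "i \<in> set_pmf N" for i
    using N[OF that] by (simp add: choices_def)
  then have ne: "choices (corr Z z) \<noteq> {}"
    using set_pmf_not_empty[of N] by blast
  have "(\<integral>\<^sup>+i. mean sup_value (a, D' i) \<partial>measure_pmf N) \<le> (\<integral>\<^sup>+i. sup_value (corr Z z) \<partial>measure_pmf N)"
    unfolding sup_value_choices[OF ne]
    by (intro nn_integral_mono_AE) (auto simp: AE_measure_pmf_iff intro: SUP_upper ch)
  then show "(\<integral>\<^sup>+z'. sup_value (corr Z z') \<partial>measure_pmf D) \<le> sup_value (corr Z z)"
    by (simp add: eq)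
  have "(\<integral>\<^sup>+i. inf_value (corr Z z) \<partial>measure_pmf N) \<le> (\<integral>\<^sup>+i. mean inf_value (a, D' i) \<partial>measure_pmf N)"
    unfolding inf_value_choices[OF ne]
    by (intro nn_integral_mono_AE) (auto simp: AE_measure_pmf_iff intro: INF_lower ch)
  then show "inf_value (corr Z z) \<le> (\<integral>\<^sup>+z'. inf_value (corr Z z') \<partial>measure_pmf D)"
    by (simp add: eq)
qed

section \<open>Optimal values and maximal resolutions\<close>

text \<open>The values pulled back along \<open>corr\<close> satisfy the comparison lemmas with
  error \<open>0\<close>. Maximality enters in the lower bound: a deadlock of \<open>Z\<close> is a
  deadlock of \<open>M\<close>, where \<open>inf_value\<close> is \<open>1\<close> or
  \<open>0\<close> according to success.\<close>

lemma maximal_resolution_bounds: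
  fixes Z :: "(nat, 'a, 's) resolution"
  assumes K: "admissible_kind K" and max: "Z \<in> Res_max K M x"
  shows "reach_prob Z (init Z) \<le> sup_value x" and "inf_value x \<le> reach_prob Z (init Z)"
proof -
  have Z: "is_resolution K M x Z"
    using max by (simp add: Res_max_def)
  have exh: "exhaustive M Z"
    by (rule maximal_imp_exhaustive[OF K nplts max])
  have init: "init Z \<in> states Z" "corr Z (init Z) = x"
    using unfolded_init[OF is_resolutionD(1,3)[OF Z]] is_resolutionD(5)[OF Z] by auto
  have "reach_prob Z (init Z) \<le> sup_value (corr Z (init Z)) + of_nat (height (corr Z (init Z))) * 0"
    by (rule reach_prob_le[OF K Z]) (auto simp: sup_value_good resolution_step_bounds(1)[OF K Z] init)
  then show "reach_prob Z (init Z) \<le> sup_value x"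
    by (simp add: init)
  have "choices (corr Z z) = {}" if "z \<in> states Z" "\<And>t. (z, t) \<notin> transitions Z" for z
    using exh that unfolding exhaustive_def choices_def by auto
  then have "inf_value (corr Z (init Z)) \<le> reach_prob Z (init Z) + of_nat (height (corr Z (init Z))) * 0"
    by (intro le_reach_prob[OF K Z])
      (auto simp: inf_value_deadlock resolution_step_bounds(2)[OF K Z] init)
  then show "inf_value x \<le> reach_prob Z (init Z)"
    by (simp add: init)
qed

text \<open>One transition satisfying \<open>R\<close> is chosen per state and the choice is
  unfolded. The result is deterministic, hence a resolution of every admissible kind, and
  exhaustive, hence maximal even against randomized extensions.\<close>

lemma memoryless_resolution:
  assumes K: "admissible_kind K" and x: "x \<in> states M"
    and near: "\<And>y. choices y \<noteq> {} \<Longrightarrow> \<exists>t\<in>choices y. R y t"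
  obtains Z :: "(nat, 'a, 's) resolution"
  where "is_resolution K M x Z" and "Z \<in> Res_max K M x"
    and "\<And>z. z \<in> states Z \<Longrightarrow> (\<And>t. (z, t) \<notin> transitions Z) \<Longrightarrow> choices (corr Z z) = {}"
    and "\<And>z a D. (z, a, D) \<in> transitions Z \<Longrightarrow> R (corr Z z) (a, map_pmf (corr Z) D)"
proof -
  obtain \<sigma> where \<sigma>: "\<And>y. choices y \<noteq> {} \<Longrightarrow> \<sigma> y \<in> choices y \<and> R y (\<sigma> y)"
    using near by metis
  define F where "F = {(y, \<sigma> y) | y. choices y \<noteq> {}}"
  have FM: "F \<subseteq> transitions M"
  proof
    fix u assume "u \<in> F"
    then obtain y where "u = (y, \<sigma> y)" "choices y \<noteq> {}" unfolding F_def by blast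
    with \<sigma> show "u \<in> transitions M" by (auto simp: choices_def)
  qed
  have Fsv: "a\<^sub>1 = a\<^sub>2 \<and> D\<^sub>1 = D\<^sub>2" if "(y, a\<^sub>1, D\<^sub>1) \<in> F" "(y, a\<^sub>2, D\<^sub>2) \<in> F" for y a\<^sub>1 D\<^sub>1 a\<^sub>2 D\<^sub>2
    using that by (simp add: F_def) (metis Pair_inject)
  have Fdom: "\<exists>a D. (y, a, D) \<in> F" if "(y, a, D) \<in> transitions M" for y a D
  proof -
    have "(y, fst (\<sigma> y), snd (\<sigma> y)) \<in> F"
      using that by (auto simp: F_def choices_def)
    then show ?thesis by blast
  qed
  show thesis
  proof (rule unfolding_exists[OF nplts x FM])
    fix Z :: "(nat, 'a, 's) resolution"
    assume Z: "is_resolution deterministic M x Z" and exh: "exhaustive M Z"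
      and tr: "\<And>z a D. (z, a, D) \<in> transitions Z \<Longrightarrow> (corr Z z, a, map_pmf (corr Z) D) \<in> F"
    have ZK: "is_resolution K M x Z"
      using K Z unfolding admissible_kind_def by (blast intro: is_resolution_mono)
    show thesis
    proof (rule that[OF ZK exhaustive_imp_maximal[OF K ZK exh]])
      show "choices (corr Z z) = {}" if "z \<in> states Z" "\<And>t. (z, t) \<notin> transitions Z" for z
        using exh that unfolding exhaustive_def choices_def by auto
      show "R (corr Z z) (a, map_pmf (corr Z) D)"
        if "(z, a, D) \<in> transitions Z" for z a D
      proof -
        from tr[OF that] have "choices (corr Z z) \<noteq> {}" "(a, map_pmf (corr Z) D) = \<sigma> (corr Z z)"
          by (auto simp: F_def)
        with \<sigma> show ?thesis by auto
      qed
    qed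
  qed (fact Fsv Fdom)+
qed

text \<open>\<open>memoryless_resolution\<close> is applied with \<open>R\<close> saying that a
  transition attains the Bellman value up to \<epsilon>; the comparison lemmas then limit the total
  loss.\<close>

lemma near_optimal_resolutions:
  assumes K: "admissible_kind K" and x: "x \<in> states M" and "0 < \<epsilon>"
  shows "\<exists>Z\<in>Res_max K M x. sup_value x \<le> reach_prob Z (init Z) + of_nat (height x) * ennreal \<epsilon>"
    and "\<exists>Z\<in>Res_max K M x. reach_prob Z (init Z) \<le> inf_value x + of_nat (height x) * ennreal \<epsilon>"
proof -
  have "\<exists>t\<in>choices y. sup_value y \<le> mean sup_value t + ennreal \<epsilon>" if "choices y \<noteq> {}" for y
  proof -
    have "sup_value y \<noteq> \<infinity>" using sup_value_le_1[of y] by (auto simp: top_unique)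
    from SUP_approx_ennreal[OF \<open>0 < \<epsilon>\<close> that sup_value_choices[OF that] this] show ?thesis
      by (blast intro: less_imp_le)
  qed
  from memoryless_resolution[OF K x this] obtain Z :: "(nat, 'a, 's) resolution"
    where Z: "is_resolution K M x Z" "Z \<in> Res_max K M x"
      and leaf: "\<And>z. z \<in> states Z \<Longrightarrow> (\<And>t. (z, t) \<notin> transitions Z) \<Longrightarrow> choices (corr Z z) = {}"
      and tr: "\<And>z a D. (z, a, D) \<in> transitions Z \<Longrightarrow>
        sup_value (corr Z z) \<le> mean sup_value (a, map_pmf (corr Z) D) + ennreal \<epsilon>"
    by metis
  have init: "init Z \<in> states Z" "corr Z (init Z) = x"
    using unfolded_init[OF is_resolutionD(1,3)[OF Z(1)]] is_resolutionD(5)[OF Z(1)] by auto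
  have "sup_value (corr Z (init Z)) \<le>
      reach_prob Z (init Z) + of_nat (height (corr Z (init Z))) * ennreal \<epsilon>"
  proof (rule le_reach_prob[OF K Z(1)])
    show "sup_value (corr Z z) \<le> (\<integral>\<^sup>+z'. sup_value (corr Z z') \<partial>measure_pmf D) + ennreal \<epsilon>"
      if "(z, a, D) \<in> transitions Z" for z a D
      using tr[OF that] by (simp add: mean_def)
  qed (simp_all add: leaf sup_value_deadlock init)
  with Z(2) init show "\<exists>Z\<in>Res_max K M x. sup_value x \<le> reach_prob Z (init Z) + of_nat (height x) * ennreal \<epsilon>"
    by auto
next
  have "\<exists>t\<in>choices y. mean inf_value t \<le> inf_value y + ennreal \<epsilon>" if "choices y \<noteq> {}" for y
  proof -
    have "inf_value y \<noteq> \<infinity>" using inf_value_le_1[of y] by (auto simp: top_unique)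
    from INF_approx_ennreal[OF \<open>0 < \<epsilon>\<close> inf_value_choices[OF that] this] show ?thesis
      by (blast intro: less_imp_le)
  qed
  from memoryless_resolution[OF K x this] obtain Z :: "(nat, 'a, 's) resolution"
    where Z: "is_resolution K M x Z" "Z \<in> Res_max K M x"
      and tr: "\<And>z a D. (z, a, D) \<in> transitions Z \<Longrightarrow>
        mean inf_value (a, map_pmf (corr Z) D) \<le> inf_value (corr Z z) + ennreal \<epsilon>"
    by metis
  have init: "init Z \<in> states Z" "corr Z (init Z) = x"
    using unfolded_init[OF is_resolutionD(1,3)[OF Z(1)]] is_resolutionD(5)[OF Z(1)] by auto
  have "reach_prob Z (init Z) \<le>
      inf_value (corr Z (init Z)) + of_nat (height (corr Z (init Z))) * ennreal \<epsilon>"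
  proof (rule reach_prob_le[OF K Z(1)])
    show "(\<integral>\<^sup>+z'. inf_value (corr Z z') \<partial>measure_pmf D) \<le> inf_value (corr Z z) + ennreal \<epsilon>"
      if "(z, a, D) \<in> transitions Z" for z a D
      using tr[OF that] by (simp add: mean_def)
  qed (simp_all add: inf_value_good init)
  with Z(2) init show "\<exists>Z\<in>Res_max K M x. reach_prob Z (init Z) \<le> inf_value x + of_nat (height x) * ennreal \<epsilon>"
    by auto
qed

text \<open>The right-hand sides do not mention \<open>K\<close>, which is what makes the two
  equivalences agree.\<close>

lemma SUP_INF_reach_prob:
  assumes K: "admissible_kind K" and x: "x \<in> states M"
  shows "(SUP Z\<in>Res_max K M x. reach_prob Z (init Z)) = sup_value x"
    and "(INF Z\<in>Res_max K M x. reach_prob Z (init Z)) = inf_value x"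
proof -
  show "(SUP Z\<in>Res_max K M x. reach_prob Z (init Z)) = sup_value x"
  proof (rule antisym)
    show "(SUP Z\<in>Res_max K M x. reach_prob Z (init Z)) \<le> sup_value x"
      by (intro SUP_least maximal_resolution_bounds(1)[OF K])
    show "sup_value x \<le> (SUP Z\<in>Res_max K M x. reach_prob Z (init Z))"
    proof (rule ennreal_le_epsilon)
      fix e :: real assume "0 < e"
      then obtain \<epsilon> where \<epsilon>: "0 < \<epsilon>" "of_nat (height x) * ennreal \<epsilon> \<le> ennreal e"
        by (rule ennreal_divided_epsilon)
      from near_optimal_resolutions(1)[OF K x \<epsilon>(1)] obtain Z where Z: "Z \<in> Res_max K M x"
        "sup_value x \<le> reach_prob Z (init Z) + of_nat (height x) * ennreal \<epsilon>" by blast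
      note Z(2)
      also have "reach_prob Z (init Z) + of_nat (height x) * ennreal \<epsilon> \<le>
          (SUP Z\<in>Res_max K M x. reach_prob Z (init Z)) + ennreal e"
        by (intro add_mono \<epsilon>(2) SUP_upper Z(1))
      finally show "sup_value x \<le> (SUP Z\<in>Res_max K M x. reach_prob Z (init Z)) + ennreal e" .
    qed
  qed
  show "(INF Z\<in>Res_max K M x. reach_prob Z (init Z)) = inf_value x"
  proof (rule antisym)
    show "inf_value x \<le> (INF Z\<in>Res_max K M x. reach_prob Z (init Z))"
      by (intro INF_greatest maximal_resolution_bounds(2)[OF K])
    show "(INF Z\<in>Res_max K M x. reach_prob Z (init Z)) \<le> inf_value x"
    proof (rule ennreal_le_epsilon)
      fix e :: real assume "0 < e"
      then obtain \<epsilon> where \<epsilon>: "0 < \<epsilon>" "of_nat (height x) * ennreal \<epsilon> \<le> ennreal e"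
        by (rule ennreal_divided_epsilon)
      from near_optimal_resolutions(2)[OF K x \<epsilon>(1)] obtain Z where Z: "Z \<in> Res_max K M x"
        "reach_prob Z (init Z) \<le> inf_value x + of_nat (height x) * ennreal \<epsilon>" by blast
      have "(INF Z\<in>Res_max K M x. reach_prob Z (init Z)) \<le> reach_prob Z (init Z)"
        by (rule INF_lower[OF Z(1)])
      also note Z(2)
      also have "inf_value x + of_nat (height x) * ennreal \<epsilon> \<le> inf_value x + ennreal e"
        by (intro add_left_mono \<epsilon>(2))
      finally show "(INF Z\<in>Res_max K M x. reach_prob Z (init Z)) \<le> inf_value x + ennreal e" .
    qed
  qed
qed

end


section \<open>Interaction systems\<close>

lemma is_nplts_interaction:
  assumes "is_nplts L" and "is_npt (actions L) T"
  shows "is_nplts (interaction L T)"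
proof -
  have T: "is_nplts T" "finite (states T)" using assms(2) by (auto simp: is_npt_def)
  show ?thesis
    using assms(1) T is_npltsD[OF assms(1)] is_npltsD[OF T(1)]
    unfolding is_nplts_def interaction_def by (fastforce simp: countable_finite)
qed

text \<open>The rank of a point is the number of points reachable from it in at least one step.
  Along an edge from \<open>x\<close> to \<open>y\<close> this set shrinks strictly, since
  \<open>y\<close> is reachable from \<open>x\<close> but, by acyclicity, not from itself.\<close>

lemma finite_acyclic_height:
  assumes fin: "finite (Range r)" and acyc: "acyclic r"
  obtains h :: "'b \<Rightarrow> nat" where "\<And>x y. (x, y) \<in> r \<Longrightarrow> h y < h x"
proof
  fix x y assume r: "(x, y) \<in> r"
  have "finite (r\<^sup>+ `` {x})"
    using fin by (rule finite_subset[rotated]) (metis Image_singleton_iff Range.intros subsetI trancl_range)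
  moreover have "r\<^sup>+ `` {y} \<subset> r\<^sup>+ `` {x}"
    using r acyc by (auto simp: acyclic_def)
  ultimately show "card (r\<^sup>+ `` {y}) < card (r\<^sup>+ `` {x})"
    by (rule psubset_card_mono)
qed

text \<open>Each step of the interaction moves the test component along an edge of the test, so a
  rank of the test states works even if \<open>L\<close> has infinite runs.\<close>

lemma interaction_bounded_depth:
  fixes L :: "('s, 'a) nplts" and T :: "('o, 'a) npt"
  assumes L: "is_nplts L" and T: "is_npt (actions L) T"
  obtains height where "bounded_depth_system (interaction L T) (\<lambda>y. snd y = success T) height"
proof -
  let ?r = "{(q, q'). \<exists>a D. (q, a, D) \<in> transitions T \<and> q' \<in> set_pmf D}"
  have nT: "is_nplts T" and fin: "finite (states T)" and acyc: "acyclic ?r"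
    and dead: "\<And>a D. (success T, a, D) \<notin> transitions T"
    using T by (auto simp: is_npt_def)
  have finr: "finite (Range ?r)"
    using fin by (rule finite_subset[rotated]) (use is_npltsD(3)[OF nT] in auto)
  show thesis
  proof (rule finite_acyclic_height[OF finr acyc])
    fix h :: "'o \<Rightarrow> nat" assume h: "\<And>q q'. (q, q') \<in> ?r \<Longrightarrow> h q' < h q"
    have "bounded_depth_system (interaction L T) (\<lambda>y. snd y = success T) (\<lambda>y. h (snd y))"
    proof
      show "is_nplts (interaction L T)" by (rule is_nplts_interaction[OF L T])
      show "(y, t) \<notin> transitions (interaction L T)" if "snd y = success T" for y t
        using that dead by (auto simp: interaction_def)
      show "h (snd y') < h (snd y)"
        if "(y, a, D) \<in> transitions (interaction L T)" "y' \<in> set_pmf D" for y a D y'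
        using that by (auto simp: interaction_def intro!: h) (intro exI conjI)
    qed
    then show thesis by (rule that)
  qed
qed

text \<open>With success as \<open>good\<close>, both sides are the same Bellman value at
  \<open>(s, q)\<close>, because both kinds are admissible.\<close>

lemma optimal_success_prob_kind_irrelevant:
  fixes L :: "('s, 'a) nplts" and T :: "('o, 'a) npt"
  assumes L: "is_nplts L" and T: "is_npt (actions L) T" and "s \<in> states L" "q \<in> states T"
  shows "(SUP Z\<in>Res_max randomized (interaction L T) (s, q). success_prob T Z) =
      (SUP Z\<in>Res_max deterministic (interaction L T) (s, q). success_prob T Z)"
    and "(INF Z\<in>Res_max randomized (interaction L T) (s, q). success_prob T Z) =
      (INF Z\<in>Res_max deterministic (interaction L T) (s, q). success_prob T Z)"
proof -
  obtain height where "bounded_depth_system (interaction L T) (\<lambda>y. snd y = success T) height"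
    using interaction_bounded_depth[OF L T] .
  then interpret bounded_depth_system "interaction L T" "\<lambda>y. snd y = success T" height .
  have eq: "success_prob T Z = reach_prob Z (init Z)" for Z :: "(nat, 'a, 's \<times> 'o) resolution"
    by (simp add: success_prob_def reach_prob_def successful_computations_def reach_computations_def)
  have x: "(s, q) \<in> states (interaction L T)"
    using assms(3,4) by (simp add: interaction_def)
  show "(SUP Z\<in>Res_max randomized (interaction L T) (s, q). success_prob T Z) =
      (SUP Z\<in>Res_max deterministic (interaction L T) (s, q). success_prob T Z)"
    unfolding eq SUP_INF_reach_prob(1)[OF admissible_kinds(1) x]
      SUP_INF_reach_prob(1)[OF admissible_kinds(2) x] ..
  show "(INF Z\<in>Res_max randomized (interaction L T) (s, q). success_prob T Z) =
      (INF Z\<in>Res_max deterministic (interaction L T) (s, q). success_prob T Z)"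
    unfolding eq SUP_INF_reach_prob(2)[OF admissible_kinds(1) x]
      SUP_INF_reach_prob(2)[OF admissible_kinds(2) x] ..
qed

theorem theorem4p4:
  fixes L :: "('s, 'a) nplts" and s\<^sub>1 s\<^sub>2 :: 's
  assumes "is_nplts L" and "s\<^sub>1 \<in> states L" and "s\<^sub>2 \<in> states L"
  shows "PTe_ct_equiv L s\<^sub>1 s\<^sub>2 \<longleftrightarrow> PTe_equiv L s\<^sub>1 s\<^sub>2"
  unfolding PTe_ct_equiv_def PTe_equiv_def PTe_sup_inf_equiv_def
  using assms by (simp add: optimal_success_prob_kind_irrelevant)

end
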